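(* For fixed integers $d\geq 4$ and $p\geq 3$, $$\mathbf{RT}_{d}(n,K_{2p-1},o(n)) = \mathbf{RT}_{d}(n,K_{2p},o(n)) = \frac{1}{2}\left(1-\frac{1}{p-1}\right)n^2+o(n^2).$$
   Context: For a graph $G=(V,E)$ and $v\in V$, $N(v)$ is the set of neighbors of $v$; the VC-dimension of $G$ is the largest $d$ such that some $d$-element $S\subset V$ satisfies: for every $B\subset S$ there is $v\in V$ with $N(v)\cap S=B$. $\mathbf{RT}_d(n,K_q,o(n))$ denotes the maximum number of edges of an $n$-vertex $K_q$-free graph of VC-dimension at most $d$ whose independence number is $o(n)$. Precisely, writing $\mathbf{RT}_d(n,K_q,m)$ for the maximum number of edges of an $n$-vertex $K_q$-free graph of VC-dimension at most $d$ with independence number at most $m$, the statement $\mathbf{RT}_d(n,K_q,o(n))=\frac12(1-\frac1{p-1})n^2+o(n^2)$ means $\lim_{\gamma\to 0^+}\limsup_{n\to\infty}\mathbf{RT}_d(n,K_q,\gamma n)/n^2=\lim_{\gamma\to 0^+}\liminf_{n\to\infty}\mathbf{RT}_d(n,K_q,\gamma n)/n^2=\frac12(1-\frac1{p-1})$. *)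

theory Defs
  imports Complex_Main "HOL-Library.Ramsey" "HOL-Library.Extended_Real" "HOL-Library.Liminf_Limsup"
begin

definition simple_graph :: "'a set \<Rightarrow> 'a set set \<Rightarrow> bool" where
  "simple_graph V E \<longleftrightarrow> finite V \<and> E \<subseteq> [V]\<^bsup>2\<^esup>"

definition neighbors :: "'a set \<Rightarrow> 'a set set \<Rightarrow> 'a \<Rightarrow> 'a set" where
  "neighbors V E v = {u \<in> V. {u, v} \<in> E}"

definition shattered :: "'a set \<Rightarrow> 'a set set \<Rightarrow> 'a set \<Rightarrow> bool" where
  "shattered V E S \<longleftrightarrow> S \<subseteq> V \<and> (\<forall>B \<subseteq> S. \<exists>v\<in>V. neighbors V E v \<inter> S = B)"

(* For a finite graph with a vertex, the set below is finite and contains 0, so the supremum is a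
   maximum. The graph without vertices shatters nothing and gets the value Sup {} = 0. *)
definition vc_dim :: "'a set \<Rightarrow> 'a set set \<Rightarrow> nat" where
  "vc_dim V E = Sup {card S | S. shattered V E S}"

definition independence_number :: "'a set \<Rightarrow> 'a set set \<Rightarrow> nat" where
  "independence_number V E = Max {card I | I. I \<subseteq> V \<and> indep I E}"

definition clique_free :: "'a set \<Rightarrow> 'a set set \<Rightarrow> nat \<Rightarrow> bool" where
  "clique_free V E q \<longleftrightarrow> \<not> (\<exists>K \<subseteq> V. card K = q \<and> clique K E)"

(* Every notion used here is invariant under isomorphism, so vertices may be taken in nat.
   Only finitely many edge counts occur for given n, so the supremum is a maximum whenever some
   graph qualifies. If none does, the value is -\<infinity>; thus a finite limit inferior of this quantity
   entails that qualifying graphs exist for all large n. *)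
definition RT :: "nat \<Rightarrow> nat \<Rightarrow> nat \<Rightarrow> real \<Rightarrow> ereal" where
  "RT d n q m = Sup {ereal (real (card E)) | (V :: nat set) E.
     simple_graph V E \<and> card V = n \<and> clique_free V E q \<and> vc_dim V E \<le> d \<and>
     real (independence_number V E) \<le> m}"

(* RT_d(n, K_q, o(n)) = c n^2 + o(n^2) *)
definition RT_asymptotic :: "nat \<Rightarrow> nat \<Rightarrow> real \<Rightarrow> bool" where
  "RT_asymptotic d q c \<longleftrightarrow>
     ((\<lambda>\<gamma>. limsup (\<lambda>n. RT d n q (\<gamma> * real n) / ereal (real n ^ 2))) \<longlongrightarrow> ereal c) (at_right 0) \<and>
     ((\<lambda>\<gamma>. liminf (\<lambda>n. RT d n q (\<gamma> * real n) / ereal (real n ^ 2))) \<longlongrightarrow> ereal c) (at_right 0)"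

end

theory Submission
  imports Defs
begin

text \<open>Upper bound: bounded VC-dimension lets one split the vertices into boundedly many classes of
  near-twins (a large separated set of neighbourhoods would have too many traces on a small sample
  for the Sauer--Shelah lemma). By double counting, almost all edges join two classes that are large
  and almost completely joined. After deletion of the other edges, Turan's bound
  still yields a clique on p vertices if there are too many edges. The p classes of its vertices are
  mutually almost complete, and as each large subset of a class spans an edge, choosing one edge per
  class greedily gives a clique on 2p vertices.

  Lower bound: join p - 1 graphs without triangles and 4-cycles that have sublinear independence
  number. Such a graph is found by adding edges one at a time; at each step the pairs that are
  forbidden because they are at distance at most 3 or contain a vertex of full degree are
  few, so some permitted pair destroys a constant proportion of the remaining large independent
  sets.\<close>

section \<open>Turan bound, Sauer--Shelah lemma and hitting sets\<close>

text \<open>Without a VC condition the even case allows more edges, because pairs of classes can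
  have density about one half (as in the Bollobas-Erdos graph). Bounded VC-dimension makes
  intermediate densities negligible, so each class can supply two vertices of a clique, and
  \<open>p\<close> classes already give \<open>2 * p\<close>. In the construction, triangle-freeness
  caps each of the \<open>p - 1\<close> parts at two vertices, so cliques have at most
  \<open>2 * p - 2\<close>. This is why both clique sizes share one constant: the upper bound is
  proved for \<open>2 * p\<close>, the lower bound for \<open>2 * p - 1\<close>, and monotonicity in
  the clique size does the rest. Forbidding 4-cycles controls the VC-dimension of the join. One
  finite sparse graph for each \<gamma> serves all large \<open>n\<close>, since disjoint copies
  keep its independence ratio. Turan's bound is applied to the vertices themselves under a pruned
  adjacency relation, which avoids a weighted reduced graph on the classes.\<close>

definition pairs :: "('a \<Rightarrow> 'b \<Rightarrow> bool) \<Rightarrow> 'a set \<Rightarrow> 'b set \<Rightarrow> ('a \<times> 'b) set" where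
  "pairs R A B = {(x, y). x \<in> A \<and> y \<in> B \<and> R x y}"

lemma pairs_Sigma: "pairs R A B = (SIGMA x:A. {y \<in> B. R x y})"
  by (auto simp: pairs_def)

lemma finite_pairs [simp]: "finite A \<Longrightarrow> finite B \<Longrightarrow> finite (pairs R A B)"
  by (simp add: pairs_Sigma)

lemma card_pairs: "finite A \<Longrightarrow> finite B \<Longrightarrow> card (pairs R A B) = (\<Sum>x\<in>A. card {y \<in> B. R x y})"
  by (simp add: pairs_Sigma)

lemma card_pairs_swap: "card (pairs R A B) = card (pairs (\<lambda>y x. R x y) B A)"
  by (rule bij_betw_same_card[of prod.swap]) (auto simp: pairs_def intro!: bij_betw_byWitness[of _ prod.swap])

lemma card_pairs_le:
  assumes "finite A" "finite B" "\<And>x. x \<in> A \<Longrightarrow> real (card {y \<in> B. R x y}) \<le> c"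
  shows "real (card (pairs R A B)) \<le> real (card A) * c"
  using sum_bounded_above[of A "\<lambda>x. real (card {y \<in> B. R x y})" c] assms
  by (simp add: card_pairs)

text \<open>Turan's bound for ordered pairs, cleared of the denominator \<open>r\<close>. If there
  is no clique on \<open>r\<close> vertices, the bound for \<open>r - 1\<close> is stronger.
  Otherwise remove such a clique: a vertex outside it has at most \<open>r - 1\<close> neighbours in
  it, and the three contributions add up to exactly the square of \<open>card V\<close>.\<close>

lemma turan_card_pairs_le:
  fixes R :: "'a \<Rightarrow> 'a \<Rightarrow> bool"
  assumes "finite V" and sym: "\<And>x y. R x y \<Longrightarrow> R y x" and irr: "\<And>x. \<not> R x x" and "r \<ge> 1"
    and "\<And>K. K \<subseteq> V \<Longrightarrow> card K = Suc r \<Longrightarrow> \<exists>x\<in>K. \<exists>y\<in>K. x \<noteq> y \<and> \<not> R x y"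
  shows "real r * real (card (pairs R V V)) \<le> (real r - 1) * real (card V) ^ 2"
  using assms(1,4,5)
proof (induction "r + card V" arbitrary: r V rule: less_induct)
  case less
  note fin = less.prems(1)
  show ?case
  proof (cases "\<exists>K\<subseteq>V. card K = r \<and> (\<forall>x\<in>K. \<forall>y\<in>K. x \<noteq> y \<longrightarrow> R x y)")
    case False
    show ?thesis
    proof (cases "r = 1")
      case True
      have "V = {}"
      proof (rule ccontr)
        assume "V \<noteq> {}"
        then obtain v where "v \<in> V" by auto
        then have "{v} \<subseteq> V \<and> card {v} = r \<and> (\<forall>x\<in>{v}. \<forall>y\<in>{v}. x \<noteq> y \<longrightarrow> R x y)"
          using True by simp
        then show False using False by blast
      qed
      then show ?thesis by (simp add: pairs_def)
    next
      case r: False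
      define s where "s = r - 1"
      have s: "r = Suc s" "s \<ge> 1" using r less.prems(2) by (auto simp: s_def)
      have "real s * real (card (pairs R V V)) \<le> (real s - 1) * real (card V) ^ 2"
        by (rule less.hyps) (use s fin False in auto)
      then have "real r * (real s * real (card (pairs R V V))) \<le> real r * ((real s - 1) * real (card V) ^ 2)"
        by (rule mult_left_mono) simp
      \<comment> \<open>For \<open>r = s + 1\<close> the product \<open>r * (s - 1)\<close> equals
        \<open>s * s - 1\<close>.\<close>
      also have "\<dots> \<le> real s * (real s * real (card V) ^ 2)"
        using s by (simp add: algebra_simps mult_right_mono)
      finally have "real s * (real r * real (card (pairs R V V))) \<le> real s * ((real r - 1) * real (card V) ^ 2)"
        using s by (simp add: algebra_simps)
      then show ?thesis using s by (simp add: mult_le_cancel_left)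
    qed
  next
    case True
    then obtain K where K: "K \<subseteq> V" "card K = r" "\<And>x y. x \<in> K \<Longrightarrow> y \<in> K \<Longrightarrow> x \<noteq> y \<Longrightarrow> R x y"
      by blast
    define W where "W = V - K"
    have finK: "finite K" and finW: "finite W" using K fin by (auto simp: W_def intro: finite_subset)
    have cW: "real (card V) = real (card W) + real r"
      using K(1,2) fin finK card_mono[OF fin K(1)] by (simp add: W_def card_Diff_subset of_nat_diff)
    have IH: "real r * real (card (pairs R W W)) \<le> (real r - 1) * real (card W) ^ 2"
    proof (rule less.hyps)
      show "r + card W < r + card V" using cW less.prems(2) by linarith
      show "\<exists>x\<in>L. \<exists>y\<in>L. x \<noteq> y \<and> \<not> R x y" if "L \<subseteq> W" "card L = Suc r" for L
        using that less.prems(3)[of L] by (auto simp: W_def)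
    qed (use finW less.prems in auto)
    have KK: "real (card (pairs R K K)) \<le> real (card K) * (real r - 1)"
    proof (rule card_pairs_le)
      fix x assume x: "x \<in> K"
      have "card {y \<in> K. R x y} \<le> card (K - {x})"
        using finK irr by (intro card_mono) auto
      then show "real (card {y \<in> K. R x y}) \<le> real r - 1"
        using x finK K(2) less.prems(2) by (simp add: of_nat_diff)
    qed (use finK in auto)
    have WK: "real (card (pairs R W K)) \<le> real (card W) * (real r - 1)"
    proof (rule card_pairs_le)
      fix w assume w: "w \<in> W"
      have "\<exists>y\<in>K. \<not> R w y"
      proof (rule ccontr)
        assume "\<not> ?thesis"
        then have a: "\<And>y. y \<in> K \<Longrightarrow> R w y" by blast
        have "card (insert w K) = Suc r" "insert w K \<subseteq> V"
          using w finK K by (auto simp: W_def)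
        from less.prems(3)[OF this(2,1)] show False using a K(3) sym by auto
      qed
      then have "card {y \<in> K. R w y} < card K"
        using finK by (intro psubset_card_mono) auto
      then show "real (card {y \<in> K. R w y}) \<le> real r - 1"
        using K(2) by linarith
    qed (use finK finW in auto)
    have "pairs R K W = prod.swap ` pairs R W K"
      using sym by (auto simp: pairs_def)
    then have KW: "card (pairs R K W) = card (pairs R W K)"
      by (simp add: card_image)
    have "pairs R V V = pairs R W W \<union> pairs R K K \<union> (pairs R W K \<union> pairs R K W)"
      using K(1) by (auto simp: pairs_def W_def)
    then have "card (pairs R V V) \<le> card (pairs R W W \<union> pairs R K K) + card (pairs R W K \<union> pairs R K W)"
      by (simp add: card_Un_le)
    also have "\<dots> \<le> (card (pairs R W W) + card (pairs R K K)) + (card (pairs R W K) + card (pairs R K W))"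
      by (intro add_mono card_Un_le)
    finally have "real (card (pairs R V V)) \<le> real (card (pairs R W W)) + real r * (real r - 1) + 2 * (real (card W) * (real r - 1))"
      using KK[unfolded K(2)] WK KW by linarith
    then have "real r * real (card (pairs R V V)) \<le> real r * (real (card (pairs R W W)) + real r * (real r - 1) + 2 * (real (card W) * (real r - 1)))"
      by (rule mult_left_mono) simp
    also have "\<dots> = real r * real (card (pairs R W W)) + (real r - 1) * (real r ^ 2 + 2 * real (card W) * real r)"
      by (simp add: algebra_simps power2_eq_square)
    also have "\<dots> \<le> (real r - 1) * real (card W) ^ 2 + (real r - 1) * (real r ^ 2 + 2 * real (card W) * real r)"
      using IH by simp
    also have "\<dots> = (real r - 1) * real (card V) ^ 2"
      by (simp add: cW algebra_simps power2_eq_square)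
    finally show ?thesis .
  qed
qed

section \<open>The Sauer-Shelah lemma\<close>

text \<open>Pajor's form of Sauer-Shelah, by induction on the ground set. Split \<open>F\<close> at
  the new point \<open>y\<close> into the members avoiding it (\<open>F0\<close>) and the members
  containing it, with \<open>y\<close> removed (\<open>F1\<close>). What either half shatters is
  shattered by \<open>F\<close>; what both shatter is shattered by \<open>F\<close> also after
  adding \<open>y\<close>. Inclusion-exclusion then gives the count.\<close>

lemma card_le_card_shattered_sets:
  assumes "finite X" "F \<subseteq> Pow X"
  shows "card F \<le> card {S. S \<subseteq> X \<and> (\<forall>B\<subseteq>S. \<exists>A\<in>F. A \<inter> S = B)}"
  using assms
proof (induction X arbitrary: F rule: finite_induct)
  case empty
  then have "F = {} \<or> F = {{}}" by auto
  then show ?case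
  proof
    assume "F = {{}}"
    then have "{S. S \<subseteq> {} \<and> (\<forall>B\<subseteq>S. \<exists>A\<in>F. A \<inter> S = B)} = {{}}" by auto
    then show ?thesis using \<open>F = {{}}\<close> by simp
  qed simp
next
  case (insert y X)
  define sh where "sh G = {S. S \<subseteq> X \<and> (\<forall>B\<subseteq>S. \<exists>A\<in>G. A \<inter> S = B)}" for G
  define T where "T = {S. S \<subseteq> insert y X \<and> (\<forall>B\<subseteq>S. \<exists>A\<in>F. A \<inter> S = B)}"
  define F0 where "F0 = {A \<in> F. y \<notin> A}"
  define F1 where "F1 = (\<lambda>A. A - {y}) ` {A \<in> F. y \<in> A}"
  have finF: "finite F" using insert by (meson finite.insertI finite_Pow_iff finite_subset)
  have finsh: "finite (sh G)" for G using insert.hyps by (simp add: sh_def)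
  have finT: "finite T" using insert.hyps by (simp add: T_def)
  have "inj_on (\<lambda>A. A - {y}) {A \<in> F. y \<in> A}" by (auto simp: inj_on_def)
  then have "card F1 = card {A \<in> F. y \<in> A}" by (simp add: F1_def card_image)
  moreover have "card F = card F0 + card {A \<in> F. y \<in> A}"
  proof -
    have "F = F0 \<union> {A \<in> F. y \<in> A}" by (auto simp: F0_def)
    moreover have "card (F0 \<union> {A \<in> F. y \<in> A}) = card F0 + card {A \<in> F. y \<in> A}"
      using finF by (intro card_Un_disjoint) (auto simp: F0_def)
    ultimately show ?thesis by simp
  qed
  ultimately have "card F = card F0 + card F1" by simp
  also have "\<dots> \<le> card (sh F0) + card (sh F1)"
    unfolding sh_def by (intro add_mono insert.IH) (use insert.prems in \<open>auto simp: F0_def F1_def\<close>)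
  also have "\<dots> = card (sh F0 \<union> sh F1) + card (sh F0 \<inter> sh F1)"
    by (rule card_Un_Int) (auto simp: finsh)
  also have "\<dots> = card (sh F0 \<union> sh F1) + card (insert y ` (sh F0 \<inter> sh F1))"
  proof -
    have "inj_on (insert y) (sh F0 \<inter> sh F1)"
      using insert.hyps(2) by (intro inj_onI) (auto simp: sh_def dest!: insert_ident[THEN iffD1, rotated 2])
    then show ?thesis by (simp add: card_image)
  qed
  also have "\<dots> = card ((sh F0 \<union> sh F1) \<union> insert y ` (sh F0 \<inter> sh F1))"
  proof (rule card_Un_disjoint[symmetric])
    have "y \<notin> S" if "S \<in> sh F0 \<union> sh F1" for S
      using that insert.hyps(2) unfolding sh_def by blast
    then show "(sh F0 \<union> sh F1) \<inter> insert y ` (sh F0 \<inter> sh F1) = {}" by blast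
  qed (use finsh in auto)
  also have "\<dots> \<le> card T"
  proof (rule card_mono[OF finT], intro Un_least)
    show "sh F0 \<subseteq> T" unfolding sh_def T_def F0_def by blast
    show "sh F1 \<subseteq> T"
    proof
      fix S assume S: "S \<in> sh F1"
      then have yS: "y \<notin> S" using insert.hyps(2) unfolding sh_def by blast
      have "\<exists>A\<in>F. A \<inter> S = B" if "B \<subseteq> S" for B
      proof -
        have "\<exists>A\<in>F1. A \<inter> S = B" using S that by (simp add: sh_def)
        then obtain A where "A \<in> F" "(A - {y}) \<inter> S = B" by (auto simp: F1_def)
        then show ?thesis using yS by (intro bexI[of _ A]) auto
      qed
      then show "S \<in> T" using S unfolding sh_def T_def by blast
    qed
    show "insert y ` (sh F0 \<inter> sh F1) \<subseteq> T"
    proof clarify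
      fix S assume S0: "S \<in> sh F0" and S1: "S \<in> sh F1"
      then have yS: "y \<notin> S" using insert.hyps(2) unfolding sh_def by blast
      have "\<exists>A\<in>F. A \<inter> insert y S = B" if B: "B \<subseteq> insert y S" for B
      proof (cases "y \<in> B")
        case True
        have "B - {y} \<subseteq> S" using B by auto
        then have "\<exists>A\<in>F1. A \<inter> S = B - {y}" using S1 by (simp add: sh_def)
        then obtain A where "A \<in> F" "y \<in> A" "(A - {y}) \<inter> S = B - {y}" by (auto simp: F1_def)
        then show ?thesis using yS True by (intro bexI[of _ A]) auto
      next
        case False
        then have "B \<subseteq> S" using B by auto
        then have "\<exists>A\<in>F0. A \<inter> S = B" using S0 by (simp add: sh_def)
        then obtain A where "A \<in> F" "y \<notin> A" "A \<inter> S = B" by (auto simp: F0_def)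
        then show ?thesis by (intro bexI[of _ A]) auto
      qed
      then show "insert y S \<in> T" using S0 unfolding sh_def T_def by blast
    qed
  qed
  finally show ?case by (simp add: T_def)
qed

text \<open>A crude replacement for a sum of binomial coefficients; only polynomial growth in
  \<open>card X\<close> matters later.\<close>

lemma card_subsets_le:
  assumes "finite X"
  shows "card {S. S \<subseteq> X \<and> card S \<le> d} \<le> (card X + 1) ^ d"
proof (induction d)
  case 0
  have "{S. S \<subseteq> X \<and> card S \<le> 0} = {{}}" using assms by (auto dest: finite_subset)
  then show ?case by simp
next
  case (Suc d)
  let ?T = "{S. S \<subseteq> X \<and> card S \<le> d}"
  have "{S. S \<subseteq> X \<and> card S \<le> Suc d} \<subseteq> insert {} ((\<lambda>(x, S). insert x S) ` (X \<times> ?T))"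
  proof
    fix S assume S: "S \<in> {S. S \<subseteq> X \<and> card S \<le> Suc d}"
    show "S \<in> insert {} ((\<lambda>(x, S). insert x S) ` (X \<times> ?T))"
    proof (cases "S = {}")
      case False
      then obtain x where x: "x \<in> S" by auto
      have "finite S" using S assms finite_subset by auto
      then have "(x, S - {x}) \<in> X \<times> ?T" using S x by auto
      moreover have "S = insert x (S - {x})" using x by auto
      ultimately show ?thesis by (metis (no_types, lifting) case_prod_conv image_eqI insertI2)
    qed simp
  qed
  then have "card {S. S \<subseteq> X \<and> card S \<le> Suc d} \<le> card (insert {} ((\<lambda>(x, S). insert x S) ` (X \<times> ?T)))"
    using assms by (intro card_mono) auto
  also have "\<dots> \<le> Suc (card ((\<lambda>(x, S). insert x S) ` (X \<times> ?T)))"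
    using assms by (simp add: card_insert_if)
  also have "\<dots> \<le> Suc (card (X \<times> ?T))"
    unfolding Suc_le_mono by (rule card_image_le) (use assms in simp)
  also have "\<dots> \<le> Suc (card X * (card X + 1) ^ d)"
    using Suc by (simp add: card_cartesian_product)
  also have "\<dots> \<le> (card X + 1) ^ Suc d" by simp
  finally show ?case .
qed

lemma sauer_shelah:
  assumes "finite X" "F \<subseteq> Pow X"
    and "\<And>S. S \<subseteq> X \<Longrightarrow> (\<And>B. B \<subseteq> S \<Longrightarrow> \<exists>A\<in>F. A \<inter> S = B) \<Longrightarrow> card S \<le> d"
  shows "card F \<le> (card X + 1) ^ d"
proof -
  have "card F \<le> card {S. S \<subseteq> X \<and> (\<forall>B\<subseteq>S. \<exists>A\<in>F. A \<inter> S = B)}"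
    by (rule card_le_card_shattered_sets[OF assms(1,2)])
  also have "\<dots> \<le> card {S. S \<subseteq> X \<and> card S \<le> d}"
    using assms by (intro card_mono) auto
  also have "\<dots> \<le> (card X + 1) ^ d" by (rule card_subsets_le[OF assms(1)])
  finally show ?thesis .
qed

section \<open>Averaging and greedy hitting sets\<close>

text \<open>Double counting of incidences: some point does at least as well as the average. It
  drives both greedy arguments, the choice of sample points in \<open>hitting_set\<close> and the
  choice of an edge in \<open>popular_new_edge\<close>.\<close>

lemma popular_point:
  fixes \<delta> :: real
  assumes "finite Y" "Y \<noteq> {}" "finite F"
    and "\<And>p. p \<in> F \<Longrightarrow> H p \<subseteq> Y" and "\<And>p. p \<in> F \<Longrightarrow> \<delta> * real (card Y) \<le> real (card (H p))"
  shows "\<exists>y\<in>Y. \<delta> * real (card F) \<le> real (card {p \<in> F. y \<in> H p})"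
proof (rule ccontr)
  assume "\<not> ?thesis"
  then have lt: "\<And>y. y \<in> Y \<Longrightarrow> real (card {p \<in> F. y \<in> H p}) < \<delta> * real (card F)" by force
  have "(\<Sum>y\<in>Y. card {p \<in> F. y \<in> H p}) = (\<Sum>p\<in>F. card {y \<in> Y. y \<in> H p})"
    using card_pairs_swap[of "\<lambda>y p. y \<in> H p" Y F] assms(1,3) by (simp add: card_pairs)
  also have "\<dots> = (\<Sum>p\<in>F. card (H p))"
    using assms(4) by (intro sum.cong refl arg_cong[where f = card]) auto
  finally have eq: "(\<Sum>y\<in>Y. real (card {p \<in> F. y \<in> H p})) = (\<Sum>p\<in>F. real (card (H p)))"
    by (metis (no_types, lifting) of_nat_sum sum.cong)
  have "(\<Sum>y\<in>Y. real (card {p \<in> F. y \<in> H p})) < (\<Sum>y\<in>Y. \<delta> * real (card F))"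
    using assms lt by (intro sum_strict_mono) auto
  also have "\<dots> = (\<Sum>p\<in>F. \<delta> * real (card Y))" by simp
  also have "\<dots> \<le> (\<Sum>p\<in>F. real (card (H p)))" using assms by (intro sum_mono) auto
  finally show False using eq by simp
qed

text \<open>A deterministic stand-in for a random sample of \<open>s\<close> points: each new point
  is popular among the sets not yet hit, so their number drops by the factor
  \<open>1 - \<delta>\<close>.\<close>

lemma hitting_set:
  fixes \<delta> :: real
  assumes "finite Y" "Y \<noteq> {}" "finite F" "\<delta> \<le> 1"
    and "\<And>p. p \<in> F \<Longrightarrow> H p \<subseteq> Y" and "\<And>p. p \<in> F \<Longrightarrow> \<delta> * real (card Y) \<le> real (card (H p))"
  shows "\<exists>Z\<subseteq>Y. card Z \<le> s \<and> real (card {p \<in> F. H p \<inter> Z = {}}) \<le> (1 - \<delta>) ^ s * real (card F)"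
proof (induction s)
  case 0
  show ?case by (rule exI[of _ "{}"]) simp
next
  case (Suc s)
  then obtain Z where Z: "Z \<subseteq> Y" "card Z \<le> s"
    "real (card {p \<in> F. H p \<inter> Z = {}}) \<le> (1 - \<delta>) ^ s * real (card F)" by blast
  define G where "G = {p \<in> F. H p \<inter> Z = {}}"
  have finG: "finite G" using assms by (simp add: G_def)
  obtain y where y: "y \<in> Y" "\<delta> * real (card G) \<le> real (card {p \<in> G. y \<in> H p})"
    using popular_point[of Y G H \<delta>] assms finG by (auto simp: G_def)
  have "{p \<in> F. H p \<inter> insert y Z = {}} = G - {p \<in> G. y \<in> H p}" by (auto simp: G_def)
  then have "real (card {p \<in> F. H p \<inter> insert y Z = {}}) = real (card G) - real (card {p \<in> G. y \<in> H p})"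
    using finG by (simp add: card_Diff_subset card_mono of_nat_diff)
  also have "\<dots> \<le> (1 - \<delta>) * real (card G)" using y by (simp add: algebra_simps)
  also have "\<dots> \<le> (1 - \<delta>) * ((1 - \<delta>) ^ s * real (card F))"
    using Z(3) assms(4) by (intro mult_left_mono) (auto simp: G_def)
  finally have "real (card {p \<in> F. H p \<inter> insert y Z = {}}) \<le> (1 - \<delta>) ^ Suc s * real (card F)"
    by simp
  moreover have "card (insert y Z) \<le> Suc s"
    using Z assms(1) by (simp add: card_insert_if finite_subset)
  ultimately show ?case using Z(1) y(1) by (intro exI[of _ "insert y Z"]) auto
qed

section \<open>Near-twin classes\<close>

lemma card_arcs:
  assumes "simple_graph V E"
  shows "card (pairs (\<lambda>x y. {x, y} \<in> E) V V) = 2 * card E"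
proof -
  have E: "finite V" "E \<subseteq> [V]\<^bsup>2\<^esup>" using assms by (auto simp: simple_graph_def)
  then have finE: "finite E" by (meson finite_imp_finite_nsets finite_subset)
  define h where "h = (\<lambda>e. {(x, y). x \<in> e \<and> y \<in> e \<and> {x, y} = e \<and> e \<in> (E :: 'a set set)})"
  have eq: "pairs (\<lambda>x y. {x, y} \<in> E) V V = (\<Union>e\<in>E. h e)"
    using E(2) by (auto simp: pairs_def h_def nsets_def)
  have two: "card (h e) = 2 \<and> finite (h e)" if e: "e \<in> E" for e
  proof -
    have "card e = 2" using e E(2) by (auto simp: nsets_def)
    then obtain a b where ab: "e = {a, b}" "a \<noteq> b" by (auto simp: card_2_iff)
    then have "h e = {(a, b), (b, a)}" using e by (auto simp: h_def doubleton_eq_iff)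
    then show ?thesis using ab by simp
  qed
  have "card (\<Union>e\<in>E. h e) = (\<Sum>e\<in>E. card (h e))"
    by (rule card_UN_disjoint) (use finE two in \<open>auto simp: h_def\<close>)
  also have "\<dots> = 2 * card E" using two by simp
  finally show ?thesis using eq by simp
qed

lemma simple_graph_irrefl: "simple_graph V E \<Longrightarrow> {x, x} \<notin> E"
  by (auto simp: simple_graph_def nsets_def)

lemma card_shattered_le:
  assumes "finite V" "shattered V E S"
  shows "card S \<le> vc_dim V E"
proof -
  have "{card S | S. shattered V E S} \<subseteq> card ` Pow V" by (auto simp: shattered_def)
  then have "finite {card S | S. shattered V E S}" by (rule finite_subset) (use assms in simp)
  then show ?thesis unfolding vc_dim_def using assms(2)
    by (intro cSup_upper bdd_above_finite) auto
qed

lemma card_indep_le: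
  assumes "finite V" "I \<subseteq> V" "indep I E"
  shows "card I \<le> independence_number V E"
proof -
  have "{card I | I. I \<subseteq> V \<and> indep I E} \<subseteq> card ` Pow V" by auto
  then have "finite {card I | I. I \<subseteq> V \<and> indep I E}" by (rule finite_subset) (use assms in simp)
  then show ?thesis unfolding independence_number_def using assms(2,3) by (intro Max_ge) auto
qed

section \<open>A packing bound for neighbourhoods\<close>

text \<open>Exponential decay beats a polynomial, in the shape that \<open>card_separated_le\<close>
  needs: \<open>(s + 1) ^ d\<close> bounds the traces on \<open>s\<close> points, and the square
  counts ordered pairs among one vertex more than that.\<close>

lemma ex_power_times_poly_less_1:
  fixes x :: real
  assumes "0 \<le> x" "x < 1"
  shows "\<exists>s. x ^ s * real ((s + 1) ^ d + 1) ^ 2 < 1"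
proof -
  define m where "m = 2 * d + 2"
  \<comment> \<open>With this root, \<open>x ^ s\<close> splits into \<open>m + 1\<close> factors
    \<open>z ^ s\<close>: \<open>m\<close> of them absorb the factors \<open>s + 1\<close>, and the
    last one makes the product less than 1.\<close>
  define z where "z = root (m + 1) x"
  have z: "0 \<le> z" "z < 1" "z ^ (m + 1) = x"
    using assms real_root_pow_pos2[of "m + 1" x] by (auto simp: z_def real_root_lt_1_iff simp del: power_Suc)
  have "(\<lambda>n. real n * z ^ n) \<longlonglongrightarrow> 0"
    by (rule powser_times_n_limit_0) (use z in auto)
  then have e1: "\<forall>\<^sub>F n in sequentially. real n * z ^ n < 1 / 2"
    by (rule order_tendstoD) simp
  have "(\<lambda>n. z ^ n) \<longlonglongrightarrow> 0" using z by (intro LIMSEQ_power_zero) auto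
  then have e2: "\<forall>\<^sub>F n in sequentially. z ^ n < 1 / 2" by (rule order_tendstoD) simp
  have "\<forall>\<^sub>F n in sequentially. real n * z ^ n < 1 / 2 \<and> z ^ n < 1 / 2 \<and> n \<ge> 2"
    by (intro eventually_conj e1 e2 eventually_ge_at_top)
  then obtain s where s: "real s * z ^ s < 1 / 2" "z ^ s < 1 / 2" "s \<ge> 2"
    unfolding eventually_sequentially by blast
  have "real ((s + 1) ^ d + 1) \<le> real (s + 1) ^ (d + 1)"
  proof -
    have "(s + 1) ^ d + 1 \<le> (s + 1) ^ d + (s + 1) ^ d" by simp
    also have "\<dots> \<le> (s + 1) * (s + 1) ^ d" using s(3) by (simp add: algebra_simps)
    finally show ?thesis by (metis Suc_eq_plus1 of_nat_le_iff of_nat_power power_Suc)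
  qed
  then have "real ((s + 1) ^ d + 1) ^ 2 \<le> (real (s + 1) ^ (d + 1)) ^ 2" by (rule power_mono) simp
  also have "\<dots> = real (s + 1) ^ m"   proof -
    have "m = (d + 1) * 2" by (simp add: m_def)
    then show ?thesis by (simp only: power_mult)
  qed
  finally have "x ^ s * real ((s + 1) ^ d + 1) ^ 2 \<le> x ^ s * real (s + 1) ^ m"
    using assms by (intro mult_left_mono) auto
  also have "x ^ s * real (s + 1) ^ m = (z ^ s) ^ m * z ^ s * real (s + 1) ^ m"
  proof -
    have "x ^ s = z ^ ((m + 1) * s)" by (simp only: z(3) power_mult)
    also have "(m + 1) * s = s * m + s" by simp
    finally show ?thesis by (simp only: power_add power_mult)
  qed
  also have "\<dots> = (real (s + 1) * z ^ s) ^ m * z ^ s"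
    by (simp add: power_mult_distrib)
  also have "\<dots> \<le> 1 * z ^ s"
  proof (rule mult_right_mono)
    have "real (s + 1) * z ^ s \<le> 1" using s by (simp add: algebra_simps)
    then show "(real (s + 1) * z ^ s) ^ m \<le> 1" using z by (intro power_le_one) auto
  qed (use z in auto)
  also have "\<dots> < 1" using s by simp
  finally show ?thesis by blast
qed

text \<open>A packing in the Hamming metric on neighbourhoods.\<close>

definition separated :: "real \<Rightarrow> 'a set \<Rightarrow> 'a set set \<Rightarrow> 'a set \<Rightarrow> bool" where
  "separated \<delta> V E W \<longleftrightarrow> W \<subseteq> V \<and> (\<forall>u\<in>W. \<forall>v\<in>W. u \<noteq> v \<longrightarrow>
     \<delta> * real (card V) \<le> real (card {w \<in> V. ({w, u} \<in> E) \<noteq> ({w, v} \<in> E)}))"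

text \<open>A weak form of Haussler's packing lemma; the bound does not depend on the size of the
  graph. A few sample points distinguish all neighbourhoods of \<open>K + 1\<close> separated
  vertices, so these leave \<open>K + 1\<close> traces on the sample, more than Sauer-Shelah
  permits.\<close>

lemma card_separated_le:
  fixes \<delta> :: real
  assumes "0 < \<delta>" "\<delta> \<le> 1"
  shows "\<exists>K. \<forall>V E (W :: 'a set). finite V \<longrightarrow> vc_dim V E \<le> d \<longrightarrow> separated \<delta> V E W \<longrightarrow> card W \<le> K"
proof -
  \<comment> \<open>The sample must hit the differences of about \<open>K ^ 2\<close> pairs, while
    \<open>K\<close> itself grows with the sample size; this choice of \<open>s\<close> settles both
    at once.\<close>
  obtain s where s: "(1 - \<delta>) ^ s * real ((s + 1) ^ d + 1) ^ 2 < 1"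
    using ex_power_times_poly_less_1[of "1 - \<delta>" d] assms by auto
  define K where "K = (s + 1) ^ d"
  have "card W \<le> K" if fin: "finite V" and vc: "vc_dim V E \<le> d" and sepW: "separated \<delta> V E W"
    for V E and W :: "'a set"
  proof (rule ccontr)
    have W: "W \<subseteq> V" and sep: "\<And>u v. u \<in> W \<Longrightarrow> v \<in> W \<Longrightarrow> u \<noteq> v \<Longrightarrow>
      \<delta> * real (card V) \<le> real (card {w \<in> V. ({w, u} \<in> E) \<noteq> ({w, v} \<in> E)})"
      using sepW by (simp_all add: separated_def)
    assume "\<not> card W \<le> K"
    then obtain U where U: "U \<subseteq> W" "card U = Suc K" "finite U"
      using obtain_subset_with_card_n[of "Suc K" W] by (metis not_less_eq_eq)
    have "V \<noteq> {}" using U W by auto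
    define F where "F = {(u, v) \<in> U \<times> U. u \<noteq> v}"
    define H where "H = (\<lambda>(u, v). {w \<in> V. ({w, u} \<in> E) \<noteq> ({w, v} \<in> E)})"
    have finF: "finite F" using U(3) by (auto simp: F_def intro: finite_subset[of _ "U \<times> U"])
    have "card F \<le> card (U \<times> U)" using U(3) by (intro card_mono) (auto simp: F_def)
    then have cF: "card F \<le> (Suc K) ^ 2" by (simp add: U card_cartesian_product power2_eq_square)
    obtain Z where Z: "Z \<subseteq> V" "card Z \<le> s"
      "real (card {p \<in> F. H p \<inter> Z = {}}) \<le> (1 - \<delta>) ^ s * real (card F)"
    proof -
      have "H p \<subseteq> V \<and> \<delta> * real (card V) \<le> real (card (H p))" if pF: "p \<in> F" for p
      proof -
        obtain u v where "p = (u, v)" "u \<in> W" "v \<in> W" "u \<noteq> v" using pF U(1) unfolding F_def by blast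
        then show ?thesis using sep[of u v] unfolding H_def by auto
      qed
      then show ?thesis
        using hitting_set[of V F \<delta> H s] fin \<open>V \<noteq> {}\<close> finF assms(2) that by blast
    qed
    note Z(3)
    also have "(1 - \<delta>) ^ s * real (card F) \<le> (1 - \<delta>) ^ s * real ((s + 1) ^ d + 1) ^ 2"
      using cF assms(2) by (intro mult_left_mono) (auto simp: K_def simp flip: of_nat_power of_nat_Suc)
    \<comment> \<open>The number of pairs that are not hit is a natural number below 1.\<close>
    finally have "card {p \<in> F. H p \<inter> Z = {}} = 0" using s by linarith
    then have "{p \<in> F. H p \<inter> Z = {}} = {}" using finF card_0_eq[of "{p \<in> F. H p \<inter> Z = {}}"] by simp
    then have hit: "H p \<inter> Z \<noteq> {}" if "p \<in> F" for p using that by blast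
    define N where "N = (\<lambda>v. neighbors V E v \<inter> Z)"
    have inj: "inj_on N U"
    proof (rule inj_onI, rule ccontr)
      fix u v assume uv: "u \<in> U" "v \<in> U" "N u = N v" "u \<noteq> v"
      then obtain w where "w \<in> H (u, v)" "w \<in> Z" using hit[of "(u, v)"] by (auto simp: F_def)
      then show False using uv(3) by (auto simp: H_def N_def neighbors_def)
    qed
    have finZ: "finite Z" using Z fin finite_subset by blast
    have "card (N ` U) \<le> (card Z + 1) ^ d"
    proof (rule sauer_shelah[OF finZ])
      show "N ` U \<subseteq> Pow Z" by (auto simp: N_def)
      fix S assume S: "S \<subseteq> Z" "\<And>B. B \<subseteq> S \<Longrightarrow> \<exists>A\<in>N ` U. A \<inter> S = B"
      have "\<exists>v\<in>V. neighbors V E v \<inter> S = B" if B: "B \<subseteq> S" for B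
      proof -
        obtain u where "u \<in> U" "N u \<inter> S = B" using S(2)[OF B] by auto
        moreover from this have "neighbors V E u \<inter> S = B" using S(1) by (auto simp: N_def)
        ultimately show ?thesis using U(1) W by blast
      qed
      then have "shattered V E S" using S(1) Z(1) by (auto simp: shattered_def)
      then show "card S \<le> d" using card_shattered_le[OF fin] vc by force
    qed
    also have "\<dots> \<le> K" unfolding K_def using Z(2) by (intro power_mono) auto
    finally show False using U(2) by (simp add: card_image[OF inj])
  qed
  then show ?thesis by blast
qed

text \<open>A separated set of maximum size is also a net: every vertex is \<delta>-close to one of
  its members, and \<open>f\<close> picks such a member. Two vertices with the same image are then
  close by the triangle inequality, whence the factor 2.\<close>

lemma near_twin_classes:
  fixes \<delta> :: real
  assumes "0 < \<delta>" "\<delta> \<le> 1"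
  shows "\<exists>K. \<forall>(V :: 'a set) E. finite V \<and> vc_dim V E \<le> d \<longrightarrow>
    (\<exists>f :: 'a \<Rightarrow> 'a. card (f ` V) \<le> K \<and> (\<forall>u\<in>V. \<forall>v\<in>V. f u = f v \<longrightarrow>
       real (card {w \<in> V. ({w, u} \<in> E) \<noteq> ({w, v} \<in> E)}) \<le> 2 * \<delta> * real (card V)))"
proof -
  obtain K where K: "\<And>V E (W :: 'a set). finite V \<Longrightarrow> vc_dim V E \<le> d \<Longrightarrow> separated \<delta> V E W \<Longrightarrow> card W \<le> K"
    using card_separated_le[OF assms, of d, where 'a = 'a] by blast
  have "\<exists>f :: 'a \<Rightarrow> 'a. card (f ` V) \<le> K \<and> (\<forall>u\<in>V. \<forall>v\<in>V. f u = f v \<longrightarrow>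
       real (card {w \<in> V. ({w, u} \<in> E) \<noteq> ({w, v} \<in> E)}) \<le> 2 * \<delta> * real (card V))"
    if fin: "finite V" and vc: "vc_dim V E \<le> d" for V :: "'a set" and E
  proof -
    define D where "D = (\<lambda>u v. {w \<in> V. ({w, u} \<in> E) \<noteq> ({w, v} \<in> E)})"
    have finD: "finite (D u v)" for u v using fin by (simp add: D_def)
    define good where "good W \<longleftrightarrow> separated \<delta> V E W" for W
    have good_iff: "good W \<longleftrightarrow> W \<subseteq> V \<and> (\<forall>u\<in>W. \<forall>v\<in>W. u \<noteq> v \<longrightarrow> \<delta> * real (card V) \<le> real (card (D u v)))" for W
      by (simp add: good_def separated_def D_def)
    have "good {}" by (simp add: good_iff)
    moreover have "\<forall>W. good W \<longrightarrow> card W < Suc (card V)" using fin by (simp add: good_iff card_mono less_Suc_eq_le)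
    ultimately have "\<exists>W. good W \<and> (\<forall>W'. good W' \<longrightarrow> card W' \<le> card W)"
      by (rule ex_has_greatest_nat)
    then obtain W where W: "good W" and max: "\<And>W'. good W' \<Longrightarrow> card W' \<le> card W"
      by blast
    have finW: "finite W" using W fin finite_subset by (auto simp: good_iff)
    have "\<exists>w\<in>W. real (card (D v w)) \<le> \<delta> * real (card V)" if v: "v \<in> V" for v
    proof (rule ccontr)
      assume neg: "\<not> ?thesis"
      have sym: "D a b = D b a" for a b by (auto simp: D_def)
      have "D v v = {}" by (simp add: D_def)
      \<comment> \<open>Otherwise \<open>w = v\<close> would be a witness, being at distance 0 from
        \<open>v\<close>.\<close>
      then have "v \<notin> W" using neg assms(1) by (metis card.empty of_nat_0 of_nat_0_le_iff less_imp_le mult_nonneg_nonneg)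
      have "\<delta> * real (card V) \<le> real (card (D v w)) \<and> \<delta> * real (card V) \<le> real (card (D w v))" if "w \<in> W" for w
        using neg that sym[of v w] by auto
      then have "good (insert v W)"
        using W v unfolding good_iff by blast
      from max[OF this] show False using \<open>v \<notin> W\<close> finW by simp
    qed
    then obtain f where f: "\<And>v. v \<in> V \<Longrightarrow> f v \<in> W \<and> real (card (D v (f v))) \<le> \<delta> * real (card V)"
      by metis
    have "card (f ` V) \<le> card W" using f finW by (intro card_mono) auto
    also have "\<dots> \<le> K" by (rule K[OF fin vc]) (use W in \<open>simp add: good_def\<close>)
    finally have "card (f ` V) \<le> K" .
    moreover have "real (card (D u v)) \<le> 2 * \<delta> * real (card V)" if uv: "u \<in> V" "v \<in> V" "f u = f v" for u v
    proof -
      have "D u v \<subseteq> D u (f u) \<union> D v (f v)" using uv(3) by (auto simp: D_def)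
      then have "card (D u v) \<le> card (D u (f u)) + card (D v (f v))"
        by (meson card_Un_le card_mono finD finite_UnI order_trans)
      then show ?thesis using f[OF uv(1)] f[OF uv(2)] by linarith
    qed
    ultimately show ?thesis by (intro exI[of _ f]) (auto simp: D_def)
  qed
  then show ?thesis by blast
qed

section \<open>Homogeneous pairs of classes and embedding of cliques\<close>

lemma real_card_pairs:
  assumes "finite A" "finite B"
  shows "real (card (pairs R A B)) = (\<Sum>x\<in>A. \<Sum>y\<in>B. of_bool (R x y))"
proof -
  have "(\<Sum>y\<in>B. of_bool (R x y)) = real (card {y \<in> B. R x y})" for x
    using assms(2) by (simp add: sum_of_bool_eq Int_def)
  then show ?thesis using assms by (simp add: card_pairs)
qed

text \<open>Each vertex of a class of size \<open>m\<close> contributes to \<open>m\<close> averages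
  with weight \<open>1 / m\<close>. This allows sums over classes to be written as sums over
  vertices.\<close>

lemma class_average:
  fixes g :: "'a \<Rightarrow> real"
  assumes "finite V"
  shows "(\<Sum>x\<in>V. (\<Sum>x'\<in>{v \<in> V. f v = f x}. g x') / real (card {v \<in> V. f v = f x})) = (\<Sum>x\<in>V. g x)"
proof -
  define P where "P x = {v \<in> V. f v = f x}" for x
  have "(\<Sum>x\<in>V. (\<Sum>x'\<in>P x. g x') / real (card (P x))) = (\<Sum>x\<in>V. \<Sum>x' | x' \<in> V \<and> f x' = f x. g x' / real (card (P x)))"
    by (simp add: P_def sum_divide_distrib)
  also have "\<dots> = (\<Sum>x'\<in>V. \<Sum>x | x \<in> V \<and> f x' = f x. g x' / real (card (P x)))"
    by (rule sum.swap_restrict) (use assms in auto)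
  also have "\<dots> = (\<Sum>x'\<in>V. g x')"
  proof (rule sum.cong[OF refl])
    fix x' assume x': "x' \<in> V"
    have "(\<Sum>x | x \<in> V \<and> f x' = f x. g x' / real (card (P x))) = (\<Sum>x\<in>P x'. g x' / real (card (P x')))"
      by (rule sum.cong) (auto simp: P_def)
    also have "\<dots> = g x'"
    proof -
      have "card (P x') \<noteq> 0" using x' assms by (auto simp: P_def)
      then show ?thesis by simp
    qed
    finally show "(\<Sum>x | x \<in> V \<and> f x' = f x. g x' / real (card (P x))) = g x'" .
  qed
  finally show ?thesis by (simp add: P_def)
qed

text \<open>A bad pair is an edge whose two classes contain more than an \<eta>-fraction of
  non-adjacent pairs. Moving from the edge \<open>x y\<close> to a non-adjacent pair
  \<open>x' y'\<close> by way of \<open>x' y\<close> changes the adjacency in one of the two moves,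
  so near-twins disagree there. Since near-twins disagree rarely, averaging over the classes bounds
  the number of bad pairs.\<close>

lemma few_bad_pairs:
  fixes A :: "'a \<Rightarrow> 'a \<Rightarrow> bool" and D \<eta> :: real
  assumes fin: "finite V" and sym: "\<And>x y. A x y \<longleftrightarrow> A y x" and "\<eta> \<ge> 0"
    and P: "P = (\<lambda>x. {v \<in> V. f v = f x})"
    and near: "\<And>u v. u \<in> V \<Longrightarrow> v \<in> V \<Longrightarrow> f u = f v \<Longrightarrow> real (card {w \<in> V. A w u \<noteq> A w v}) \<le> D"
  shows "\<eta> * real (card (pairs (\<lambda>x y. A x y \<and>
      \<eta> * real (card (P x)) * real (card (P y)) < real (card (pairs (\<lambda>x y. \<not> A x y) (P x) (P y)))) V V))
    \<le> 2 * D * real (card V)"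
proof -
  define bad where "bad x y \<longleftrightarrow> A x y \<and> \<eta> * real (card (P x)) * real (card (P y)) <
    real (card (pairs (\<lambda>x y. \<not> A x y) (P x) (P y)))" for x y
  define s :: "'a \<Rightarrow> 'a \<Rightarrow> 'a \<Rightarrow> real" where "s w u v = of_bool (A w u \<noteq> A w v)" for w u v
  \<comment> \<open>The fraction of the class of \<open>y\<close> whose adjacency to
    \<open>x\<close> differs from that of \<open>y\<close>.\<close>
  define h where "h x y = (\<Sum>y'\<in>P y. s x y y') / real (card (P y))" for x y
  have finP: "finite (P x)" for x using fin by (simp add: P)
  have cP: "real (card (P x)) > 0" if "x \<in> V" for x
    using that finP[of x] by (auto simp: P card_gt_0_iff)
  have hsum: "(\<Sum>y\<in>V. \<Sum>x\<in>V. h x y) \<le> real (card V) * D"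
  proof -
    have "(\<Sum>x\<in>V. h x y) \<le> D" if y: "y \<in> V" for y
    proof -
      have "(\<Sum>x\<in>V. h x y) = (\<Sum>y'\<in>P y. \<Sum>x\<in>V. s x y y') / real (card (P y))"
        unfolding h_def sum_divide_distrib[symmetric] by (subst sum.swap) simp
      also have "(\<Sum>y'\<in>P y. \<Sum>x\<in>V. s x y y') \<le> (\<Sum>y'\<in>P y. D)"
      proof (rule sum_mono)
        fix y' assume "y' \<in> P y"
        then have "real (card {w \<in> V. A w y \<noteq> A w y'}) \<le> D" using y near by (auto simp: P)
        then show "(\<Sum>x\<in>V. s x y y') \<le> D"
          using fin by (simp add: s_def sum_of_bool_eq Int_def del: of_bool_not_iff)
      qed
      finally show ?thesis using cP[OF y] by (simp add: divide_right_mono)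
    qed
    then show ?thesis using sum_bounded_above[of V "\<lambda>y. \<Sum>x\<in>V. h x y" D] by simp
  qed
  have pt: "\<eta> * of_bool (bad x y) \<le> h y x + (\<Sum>x'\<in>P x. h x' y) / real (card (P x))"
    if xy: "x \<in> V" "y \<in> V" for x y
  proof (cases "bad x y")
    case True
    let ?c = "real (card (P x)) * real (card (P y))"
    have "\<eta> * ?c \<le> (\<Sum>x'\<in>P x. \<Sum>y'\<in>P y. of_bool (\<not> A x' y'))"
      using True finP by (simp add: bad_def real_card_pairs mult.assoc)
    also have "\<dots> \<le> (\<Sum>x'\<in>P x. \<Sum>y'\<in>P y. s y x x' + s x' y y')"
    proof (intro sum_mono)
      fix x' y'
      \<comment> \<open>If \<open>x'\<close> and \<open>y'\<close> are not adjacent, either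
        \<open>y\<close> separates \<open>x\<close> from \<open>x'\<close>, or \<open>y\<close> is
        adjacent to \<open>x'\<close> and then \<open>x'\<close> separates \<open>y\<close> from
        \<open>y'\<close>.\<close>
      have "A y x" using True sym by (auto simp: bad_def)
      then show "of_bool (\<not> A x' y') \<le> s y x x' + s x' y y'"
        using sym[of x' y] by (auto simp: s_def)
    qed
    also have "\<dots> = (h y x + (\<Sum>x'\<in>P x. h x' y) / real (card (P x))) * ?c"
      using cP[OF xy(1)] cP[OF xy(2)]
      by (simp add: h_def sum.distrib sum_divide_distrib[symmetric] sum_distrib_left[symmetric] field_simps)
    finally show ?thesis using True cP[OF xy(1)] cP[OF xy(2)] by simp
  next
    case False
    then show ?thesis
      by (simp add: h_def s_def sum_nonneg divide_nonneg_nonneg)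
  qed
  have "\<eta> * real (card (pairs bad V V)) = (\<Sum>x\<in>V. \<Sum>y\<in>V. \<eta> * of_bool (bad x y))"
    unfolding real_card_pairs[OF fin fin] sum_distrib_left by (rule refl)
  also have "\<dots> \<le> (\<Sum>x\<in>V. \<Sum>y\<in>V. h y x + (\<Sum>x'\<in>P x. h x' y) / real (card (P x)))"
    by (intro sum_mono pt)
  also have "\<dots> = (\<Sum>x\<in>V. \<Sum>y\<in>V. h y x) + (\<Sum>y\<in>V. \<Sum>x\<in>V. (\<Sum>x'\<in>P x. h x' y) / real (card (P x)))"
    by (simp only: sum.distrib) (subst (3) sum.swap, simp)
  also have "(\<Sum>y\<in>V. \<Sum>x\<in>V. (\<Sum>x'\<in>P x. h x' y) / real (card (P x))) = (\<Sum>y\<in>V. \<Sum>x\<in>V. h x y)"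
    unfolding P by (intro sum.cong refl class_average fin)
  also have "(\<Sum>x\<in>V. \<Sum>y\<in>V. h y x) + \<dots> \<le> 2 * D * real (card V)"
    using hsum by (simp add: mult.commute)
  finally show ?thesis by (simp add: bad_def[abs_def])
qed

section \<open>Greedy embedding of cliques\<close>

text \<open>Choose an edge in the last class among vertices that are typical for all other classes,
  and restrict those classes to the common neighbours of its ends. Each class keeps at least half of
  its vertices, so the proportion of non-adjacent pairs grows at most by 4 in each round; this
  explains \<open>4 ^ p\<close> and \<open>2 ^ p\<close>.\<close>

lemma clique_in_dense_classes:
  fixes A :: "'a \<Rightarrow> 'a \<Rightarrow> bool" and U :: "nat \<Rightarrow> 'a set"
  assumes sym: "\<And>x y. A x y \<Longrightarrow> A y x" and irr: "\<And>x. \<not> A x x"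
    and "\<And>i. i < p \<Longrightarrow> finite (U i) \<and> U i \<noteq> {}"
    and "\<And>i j. i < p \<Longrightarrow> j < p \<Longrightarrow> i \<noteq> j \<Longrightarrow>
      real (card (pairs (\<lambda>x y. \<not> A x y) (U i) (U j))) \<le> real (card (U i)) * real (card (U j)) / (2 * 4 ^ p)"
    and "\<And>i X. i < p \<Longrightarrow> X \<subseteq> U i \<Longrightarrow> real (card (U i)) / 2 ^ p \<le> real (card X) \<Longrightarrow>
      \<exists>x\<in>X. \<exists>y\<in>X. A x y"
  shows "\<exists>K\<subseteq>(\<Union>i<p. U i). card K = 2 * p \<and> (\<forall>x\<in>K. \<forall>y\<in>K. x \<noteq> y \<longrightarrow> A x y)"
  using assms(3-5)
proof (induction p arbitrary: U)
  case 0
  show ?case by (rule exI[of _ "{}"]) simp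
next
  case (Suc p)
  note fin = Suc.prems(1) and dens = Suc.prems(2) and edge = Suc.prems(3)
  have cU: "real (card (U i)) > 0" if "i < Suc p" for i
    using fin[OF that] by (simp add: card_gt_0_iff)
  \<comment> \<open>With the threshold 1/4, the two ends of the chosen edge together exclude at most
    half of \<open>U i\<close>.\<close>
  define B where "B i = {x \<in> U p. real (card (U i)) / 4 < real (card {y \<in> U i. \<not> A x y})}" for i
  have finB: "finite (B i)" for i using fin[of p] by (simp add: B_def)
  have cB: "real (card (B i)) \<le> real (card (U p)) / (2 * 4 ^ p)" if i: "i < p" for i
  proof -
    have "real (card (B i)) * (real (card (U i)) / 4) = (\<Sum>x\<in>B i. real (card (U i)) / 4)" by simp
    also have "\<dots> \<le> (\<Sum>x\<in>B i. real (card {y \<in> U i. \<not> A x y}))"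
      by (intro sum_mono) (auto simp: B_def)
    also have "\<dots> \<le> (\<Sum>x\<in>U p. real (card {y \<in> U i. \<not> A x y}))"
      by (rule sum_mono2) (use fin[of p] in \<open>auto simp: B_def\<close>)
    also have "\<dots> = real (card (pairs (\<lambda>x y. \<not> A x y) (U p) (U i)))"
      using fin i by (simp add: card_pairs)
    also have "\<dots> \<le> real (card (U p)) * real (card (U i)) / (2 * 4 ^ Suc p)"
      using i by (intro dens) auto
    finally show ?thesis using cU[of i] i by (simp add: field_simps)
  qed
  define X where "X = U p - (\<Union>i<p. B i)"
  have "real (card (\<Union>i<p. B i)) \<le> (\<Sum>i<p. real (card (B i)))"
    by (metis card_UN_le finite_lessThan of_nat_le_iff of_nat_sum)
  also have "\<dots> \<le> real p * (real (card (U p)) / (2 * 4 ^ p))"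
    using sum_bounded_above[of "{..<p}" "\<lambda>i. real (card (B i))" "real (card (U p)) / (2 * 4 ^ p)"] cB by simp
  also have "\<dots> \<le> real (card (U p)) / 2"
  proof -
    have "p \<le> 4 ^ p" by (rule less_imp_le, rule less_exp[THEN order_less_le_trans], rule power_mono) auto
    then have "real p \<le> 4 ^ p" by (metis of_nat_le_iff of_nat_numeral of_nat_power)
    then have "real p * real (card (U p)) \<le> 4 ^ p * real (card (U p))" by (rule mult_right_mono) simp
    then show ?thesis by (simp add: field_simps)
  qed
  finally have "real (card (\<Union>i<p. B i)) \<le> real (card (U p)) / 2" .
  moreover have "card X = card (U p) - card (\<Union>i<p. B i)"
    unfolding X_def by (rule card_Diff_subset) (use finB in \<open>auto simp: B_def\<close>)
  ultimately have "real (card (U p)) / 2 \<le> real (card X)" by linarith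
  moreover have "real (card (U p)) / 2 ^ Suc p \<le> real (card (U p)) / 2"
    by (intro divide_left_mono) auto
  ultimately obtain x y where xy: "x \<in> X" "y \<in> X" "A x y"
    using edge[of p X] by (auto simp: X_def)
  define U' where "U' i = {u \<in> U i. A x u \<and> A y u}" for i
  have big: "real (card (U i)) / 2 \<le> real (card (U' i))" if i: "i < p" for i
  proof -
    have few: "real (card {u \<in> U i. \<not> A z u}) \<le> real (card (U i)) / 4" if "z \<in> X" for z
      using that i by (force simp: X_def B_def)
    have "U i = U' i \<union> ({u \<in> U i. \<not> A x u} \<union> {u \<in> U i. \<not> A y u})" by (auto simp: U'_def)
    then have "card (U i) \<le> card (U' i) + card ({u \<in> U i. \<not> A x u} \<union> {u \<in> U i. \<not> A y u})"
      by (metis card_Un_le)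
    also have "\<dots> \<le> card (U' i) + (card {u \<in> U i. \<not> A x u} + card {u \<in> U i. \<not> A y u})"
      by (intro add_left_mono card_Un_le)
    finally show ?thesis using few[OF xy(1)] few[OF xy(2)] by linarith
  qed
  have sub: "U' i \<subseteq> U i" for i by (auto simp: U'_def)
  have "\<exists>K\<subseteq>(\<Union>i<p. U' i). card K = 2 * p \<and> (\<forall>x\<in>K. \<forall>y\<in>K. x \<noteq> y \<longrightarrow> A x y)"
  proof (rule Suc.IH)
    fix i assume i: "i < p"
    show "finite (U' i) \<and> U' i \<noteq> {}"
      using big[OF i] cU[of i] fin[of i] i sub[of i] by (auto intro: finite_subset)
    fix j assume j: "j < p" "i \<noteq> j"
    have "card (pairs (\<lambda>x y. \<not> A x y) (U' i) (U' j)) \<le> card (pairs (\<lambda>x y. \<not> A x y) (U i) (U j))"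
      using fin i j sub by (intro card_mono) (auto simp: pairs_def dest: subsetD[OF sub] intro: finite_subset[OF _ finite_cartesian_product])
    also have "real \<dots> \<le> real (card (U i)) * real (card (U j)) / (2 * 4 ^ Suc p)"
      using i j by (intro dens) auto
    also have "\<dots> = (real (card (U i)) / 2) * (real (card (U j)) / 2) / (2 * 4 ^ p)" by simp
    also have "\<dots> \<le> real (card (U' i)) * real (card (U' j)) / (2 * 4 ^ p)"
      using big i j by (intro divide_right_mono mult_mono) auto
    finally show "real (card (pairs (\<lambda>x y. \<not> A x y) (U' i) (U' j))) \<le> real (card (U' i)) * real (card (U' j)) / (2 * 4 ^ p)"
      by simp
  next
    fix i Y assume i: "i < p" and Y: "Y \<subseteq> U' i" "real (card (U' i)) / 2 ^ p \<le> real (card Y)"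
    have "real (card (U i)) / 2 ^ Suc p = (real (card (U i)) / 2) / 2 ^ p" by simp
    also have "\<dots> \<le> real (card (U' i)) / 2 ^ p" using big[OF i] by (rule divide_right_mono) simp
    also note Y(2)
    finally show "\<exists>x\<in>Y. \<exists>y\<in>Y. A x y" using edge[of i Y] i Y(1) sub[of i] by auto
  qed
  then obtain K where K: "K \<subseteq> (\<Union>i<p. U' i)" "card K = 2 * p" "\<And>x y. x \<in> K \<Longrightarrow> y \<in> K \<Longrightarrow> x \<noteq> y \<Longrightarrow> A x y"
    by blast
  have finK: "finite K" using K(1) fin sub by (meson finite_UN_I finite_lessThan finite_subset lessThan_iff less_SucI)
  have adj: "A x u \<and> A y u" if "u \<in> K" for u using that K(1) by (auto simp: U'_def)
  \<comment> \<open>The new vertices are distinct from the old ones by irreflexivity alone: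
    \<open>x\<close> and \<open>y\<close> are adjacent to everything in \<open>K\<close>.\<close>
  have "x \<notin> K" "y \<notin> K" "x \<noteq> y" using adj irr xy(3) by metis+
  then have "card (insert x (insert y K)) = 2 * Suc p" using finK K(2) by simp
  moreover have "insert x (insert y K) \<subseteq> (\<Union>i<Suc p. U i)"
    using K(1) sub xy by (fastforce simp: X_def)
  moreover have "\<forall>a\<in>insert x (insert y K). \<forall>b\<in>insert x (insert y K). a \<noteq> b \<longrightarrow> A a b"
    using K(3) adj sym xy(3) by blast
  ultimately show ?case by blast
qed

section \<open>The upper bound\<close>

text \<open>The constants depend on each other in the order \<eta>, \<delta>, \<open>K\<close>,
  \<mu>, \<gamma>. Bad pairs and pairs meeting small classes each cost at most \<epsilon> times the
  square of \<open>card V\<close> in ordered pairs, hence \<epsilon> in total for edges.\<close>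

lemma card_edges_le:
  fixes \<epsilon> :: real
  assumes p: "p \<ge> 2" and eps: "\<epsilon> > 0"
  shows "\<exists>\<gamma>>0. \<forall>(V :: 'a set) E. simple_graph V E \<longrightarrow> V \<noteq> {} \<longrightarrow> clique_free V E (2 * p) \<longrightarrow> vc_dim V E \<le> d \<longrightarrow>
    real (independence_number V E) \<le> \<gamma> * real (card V) \<longrightarrow>
    real (card E) \<le> (1 / 2 * (1 - 1 / (real p - 1)) + \<epsilon>) * real (card V) ^ 2"
proof -
  \<comment> \<open>The density demanded by \<open>clique_in_dense_classes\<close>.\<close>
  define \<eta> :: real where "\<eta> = 1 / (2 * 4 ^ p)"
  \<comment> \<open>Near-twins differ on at most \<open>2 * \<delta> * n\<close> vertices, so
    \<open>few_bad_pairs\<close> gives at most \<open>4 * \<delta> / \<eta> * n\<^sup>2\<close> bad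
    pairs.\<close>
  define \<delta> where "\<delta> = min 1 (\<epsilon> * \<eta> / 4)"
  have \<eta>: "\<eta> > 0" by (simp add: \<eta>_def)
  have \<delta>: "0 < \<delta>" "\<delta> \<le> 1" "4 * \<delta> \<le> \<epsilon> * \<eta>" using eps \<eta> by (auto simp: \<delta>_def)
  obtain K where K: "\<And>(V :: 'a set) E. finite V \<and> vc_dim V E \<le> d \<Longrightarrow>
    \<exists>f :: 'a \<Rightarrow> 'a. card (f ` V) \<le> K \<and> (\<forall>u\<in>V. \<forall>v\<in>V. f u = f v \<longrightarrow>
       real (card {w \<in> V. ({w, u} \<in> E) \<noteq> ({w, v} \<in> E)}) \<le> 2 * \<delta> * real (card V))"
    using near_twin_classes[OF \<delta>(1,2), of d, where 'a = 'a] by (elim exE) blast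
  \<comment> \<open>At most \<open>K\<close> classes are smaller than \<open>\<mu> * n\<close>; the
    ordered pairs meeting them number at most \<open>2 * K * \<mu> * n\<^sup>2\<close>.\<close>
  define \<mu> where "\<mu> = \<epsilon> / (2 * (real K + 1))"
  have \<mu>: "\<mu> > 0" "2 * (\<mu> * real K) \<le> \<epsilon>"
    using eps by (auto simp: \<mu>_def field_simps)
  \<comment> \<open>A subset holding a \<open>2 ^ p\<close>-th of a class that is not small must
    exceed the independence number and so span an edge.\<close>
  define \<gamma> where "\<gamma> = \<mu> / 2 ^ (p + 1)"
  have \<gamma>: "\<gamma> > 0" "\<gamma> < \<mu> / 2 ^ p" using \<mu> by (auto simp: \<gamma>_def field_simps)
  show ?thesis
  proof (intro exI[of _ \<gamma>] conjI allI impI)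
    fix V :: "'a set" and E
    assume sg: "simple_graph V E" and ne: "V \<noteq> {}" and cf: "clique_free V E (2 * p)"
      and vc: "vc_dim V E \<le> d" and ind: "real (independence_number V E) \<le> \<gamma> * real (card V)"
    have fin: "finite V" using sg by (simp add: simple_graph_def)
    define n where "n = real (card V)"
    have n: "n > 0" using fin ne by (simp add: n_def card_gt_0_iff)
    define A where "A x y \<longleftrightarrow> {x, y} \<in> E" for x y
    have symA: "A x y \<longleftrightarrow> A y x" for x y by (simp add: A_def insert_commute)
    have irrA: "\<not> A x x" for x using simple_graph_irrefl[OF sg, of x] by (simp add: A_def)
    obtain f :: "'a \<Rightarrow> 'a" where f: "card (f ` V) \<le> K"
      "\<And>u v. u \<in> V \<Longrightarrow> v \<in> V \<Longrightarrow> f u = f v \<Longrightarrow> real (card {w \<in> V. A w u \<noteq> A w v}) \<le> 2 * \<delta> * n"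
      using K[of V E] fin vc unfolding A_def n_def by blast
    define P where "P = (\<lambda>x. {v \<in> V. f v = f x})"
    have finP: "finite (P x)" for x using fin by (simp add: P_def)
    define bad where "bad x y \<longleftrightarrow> A x y \<and>
      \<eta> * real (card (P x)) * real (card (P y)) < real (card (pairs (\<lambda>x y. \<not> A x y) (P x) (P y)))" for x y
    define small where "small x \<longleftrightarrow> real (card (P x)) < \<mu> * n" for x
    \<comment> \<open>An \<open>R\<close>-clique may contain two vertices of the same class;
      \<open>clique_in_dense_classes\<close> accepts repeated classes, so edges inside a class go
      through the same argument.\<close>
    define R where "R x y \<longleftrightarrow> x \<in> V \<and> y \<in> V \<and> A x y \<and> \<not> bad x y \<and> \<not> small x \<and> \<not> small y" for x y
    have badsym: "bad x y \<longleftrightarrow> bad y x" for x y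
    proof -
      have "card (pairs (\<lambda>x y. \<not> A x y) (P x) (P y)) = card (pairs (\<lambda>x y. \<not> A x y) (P y) (P x))"
        by (subst card_pairs_swap) (simp add: symA[symmetric])
      then show ?thesis using symA[of x y] by (simp add: bad_def mult_ac)
    qed
    have nbad: "real (card (pairs bad V V)) \<le> \<epsilon> * n\<^sup>2"
    proof -
      have "\<eta> * real (card (pairs bad V V)) \<le> 2 * (2 * \<delta> * n) * real (card V)"
        unfolding bad_def[abs_def]
        by (rule few_bad_pairs[OF fin symA _ P_def]) (use \<eta> f(2) in auto)
      also have "\<dots> = (4 * \<delta>) * n\<^sup>2" by (simp add: n_def power2_eq_square)
      also have "\<dots> \<le> \<epsilon> * \<eta> * n\<^sup>2" by (rule mult_right_mono) (use \<delta> in auto)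
      finally show ?thesis using \<eta> by (simp add: mult_ac)
    qed
    have nsmall: "2 * (real (card {x \<in> V. small x}) * n) \<le> \<epsilon> * n\<^sup>2"
    proof -
      have eq: "{x \<in> V. small x} = (\<Union>i\<in>f ` {x \<in> V. small x}. {v \<in> V. f v = i})"
        by (auto simp: small_def P_def)
      have "card (\<Union>i\<in>f ` {x \<in> V. small x}. {v \<in> V. f v = i}) \<le> (\<Sum>i\<in>f ` {x \<in> V. small x}. card {v \<in> V. f v = i})"
        by (rule card_UN_le) (use fin in simp)
      then have "card {x \<in> V. small x} \<le> (\<Sum>i\<in>f ` {x \<in> V. small x}. card {v \<in> V. f v = i})"
        by (rule ord_eq_le_trans[OF arg_cong[OF eq]])
      then have "real (card {x \<in> V. small x}) \<le> (\<Sum>i\<in>f ` {x \<in> V. small x}. real (card {v \<in> V. f v = i}))"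
        unfolding of_nat_sum[symmetric] of_nat_le_iff .
      also have "\<dots> \<le> (\<Sum>i\<in>f ` {x \<in> V. small x}. \<mu> * n)"
        by (rule sum_mono) (auto simp: small_def P_def)
      also have "\<dots> = real (card (f ` {x \<in> V. small x})) * (\<mu> * n)" by simp
      also have "\<dots> \<le> real K * (\<mu> * n)"
      proof (rule mult_right_mono)
        have "card (f ` {x \<in> V. small x}) \<le> card (f ` V)" using fin by (intro card_mono) auto
        then show "real (card (f ` {x \<in> V. small x})) \<le> real K" using f(1) by linarith
      qed (use \<mu> n in auto)
      finally have "2 * (real (card {x \<in> V. small x}) * n) \<le> 2 * (real K * (\<mu> * n) * n)"
        using n by (intro mult_left_mono mult_right_mono) auto
      also have "\<dots> = (2 * (\<mu> * real K)) * n\<^sup>2" by (simp add: power2_eq_square)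
      also have "\<dots> \<le> \<epsilon> * n\<^sup>2" by (rule mult_right_mono) (use \<mu> in auto)
      finally show ?thesis .
    qed
    have noK: "\<exists>x\<in>Q. \<exists>y\<in>Q. x \<noteq> y \<and> \<not> R x y" if Q: "Q \<subseteq> V" "card Q = Suc (p - 1)" for Q
    proof (rule ccontr)
      assume "\<not> ?thesis"
      then have RQ: "\<And>x y. x \<in> Q \<Longrightarrow> y \<in> Q \<Longrightarrow> x \<noteq> y \<Longrightarrow> R x y" by blast
      have cQ: "card Q = p" using Q p by simp
      have finQ: "finite Q" using Q(1) fin by (rule finite_subset)
      then obtain g where g: "bij_betw g {0..<p} Q" using ex_bij_betw_nat_finite[OF finQ] cQ by auto
      have gQ: "g i \<in> Q" if "i < p" for i using g that by (auto simp: bij_betw_def)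
      have gR: "R (g i) (g j)" if "i < p" "j < p" "i \<noteq> j" for i j
    proof (rule RQ)
      show "g i \<noteq> g j" using bij_betw_imp_inj_on[OF g] that by (simp add: inj_on_eq_iff)
    qed (use gQ that in auto)
      \<comment> \<open>\<open>R\<close> records that a class is not small only for the ends of a
        related pair, so every index needs a partner.\<close>
      have ex: "\<exists>j<p. j \<noteq> i" for i using p by (intro exI[of _ "if i = 0 then 1 else 0"]) auto
      have big: "\<mu> * n \<le> real (card (P (g i)))" if "i < p" for i
      proof -
        obtain j where "j < p" "j \<noteq> i" using ex by blast
        then have "R (g i) (g j)" using that by (intro gR) auto
        then show ?thesis by (simp add: R_def small_def)
      qed
      have "\<exists>L\<subseteq>(\<Union>i<p. P (g i)). card L = 2 * p \<and> (\<forall>x\<in>L. \<forall>y\<in>L. x \<noteq> y \<longrightarrow> A x y)"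
      proof (rule clique_in_dense_classes)
        fix i assume i: "i < p"
        have "0 < \<mu> * n" using \<mu> n by simp
        then have "card (P (g i)) \<noteq> 0" using big[OF i] by linarith
        then show "finite (P (g i)) \<and> P (g i) \<noteq> {}" using finP by auto
        fix X assume X: "X \<subseteq> P (g i)" "real (card (P (g i))) / 2 ^ p \<le> real (card X)"
        show "\<exists>x\<in>X. \<exists>y\<in>X. A x y"
        proof (rule ccontr)
          assume "\<not> ?thesis"
          then have "indep X E" by (auto simp: indep_def A_def)
          moreover have "X \<subseteq> V" using X(1) by (auto simp: P_def)
          ultimately have "card X \<le> independence_number V E" using fin by (intro card_indep_le)
          then have "real (card X) \<le> \<gamma> * n" using ind unfolding n_def by linarith
          moreover have "\<gamma> * n < \<mu> / 2 ^ p * n" using \<gamma>(2) n by (rule mult_strict_right_mono)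
          moreover have "\<mu> / 2 ^ p * n \<le> real (card (P (g i))) / 2 ^ p"
            using divide_right_mono[OF big[OF i], of "2 ^ p"] by simp
          ultimately show False using X(2) by linarith
        qed
      next
        fix i j assume "i < p" "j < p" "i \<noteq> j"
        from gR[OF this] show "real (card (pairs (\<lambda>x y. \<not> A x y) (P (g i)) (P (g j))))
          \<le> real (card (P (g i))) * real (card (P (g j))) / (2 * 4 ^ p)"
          by (auto simp: R_def bad_def \<eta>_def)
      qed (use symA irrA in auto)
      then obtain L where L: "L \<subseteq> (\<Union>i<p. P (g i))" "card L = 2 * p" "\<forall>x\<in>L. \<forall>y\<in>L. x \<noteq> y \<longrightarrow> A x y"
        by blast
      have "L \<subseteq> V" using L(1) by (auto simp: P_def)
      moreover have "clique L E" using L(3) by (simp add: clique_def A_def)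
      ultimately show False using cf L(2) by (auto simp: clique_free_def)
    qed
    have "real (p - 1) * real (card (pairs R V V)) \<le> (real (p - 1) - 1) * real (card V) ^ 2"
      by (rule turan_card_pairs_le[OF fin _ _ _ noK]) (use symA badsym irrA p in \<open>auto simp: R_def\<close>)
    then have nR: "real (card (pairs R V V)) \<le> (1 - 1 / (real p - 1)) * n\<^sup>2"
      using p by (simp add: n_def field_simps of_nat_diff)
    have "pairs A V V \<subseteq> (pairs R V V \<union> pairs bad V V) \<union> ({x \<in> V. small x} \<times> V \<union> V \<times> {x \<in> V. small x})"
      by (auto simp: pairs_def R_def)
    then have "card (pairs A V V) \<le> card ((pairs R V V \<union> pairs bad V V) \<union> ({x \<in> V. small x} \<times> V \<union> V \<times> {x \<in> V. small x}))"
      using fin by (intro card_mono) auto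
    also have "\<dots> \<le> card (pairs R V V \<union> pairs bad V V) + card ({x \<in> V. small x} \<times> V \<union> V \<times> {x \<in> V. small x})"
      by (rule card_Un_le)
    also have "\<dots> \<le> (card (pairs R V V) + card (pairs bad V V)) + (card ({x \<in> V. small x} \<times> V) + card (V \<times> {x \<in> V. small x}))"
      by (intro add_mono card_Un_le)
    finally have "card (pairs A V V) \<le> card (pairs R V V) + card (pairs bad V V) + 2 * (card {x \<in> V. small x} * card V)"
      by (simp add: card_cartesian_product mult.commute)
    then have "real (card (pairs A V V)) \<le> real (card (pairs R V V)) + real (card (pairs bad V V)) + 2 * (real (card {x \<in> V. small x}) * n)"
      unfolding n_def by (simp flip: of_nat_le_iff[where 'a = real])
    also have "\<dots> \<le> (1 - 1 / (real p - 1)) * n\<^sup>2 + \<epsilon> * n\<^sup>2 + \<epsilon> * n\<^sup>2"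
      using nR nbad nsmall by linarith
    also have "real (card (pairs A V V)) = 2 * real (card E)"
      using card_arcs[OF sg] by (simp add: A_def[abs_def])
    finally have fin_le: "2 * real (card E) \<le> (1 - 1 / (real p - 1)) * n\<^sup>2 + \<epsilon> * n\<^sup>2 + \<epsilon> * n\<^sup>2" .
    show "real (card E) \<le> (1 / 2 * (1 - 1 / (real p - 1)) + \<epsilon>) * real (card V) ^ 2"
    proof -
      have "(1 / 2 * X + \<epsilon>) * n\<^sup>2 = (X * n\<^sup>2 + \<epsilon> * n\<^sup>2 + \<epsilon> * n\<^sup>2) / 2" for X by (simp add: algebra_simps)
      then have eq: "(1 / 2 * (1 - 1 / (real p - 1)) + \<epsilon>) * n\<^sup>2 =
        ((1 - 1 / (real p - 1)) * n\<^sup>2 + \<epsilon> * n\<^sup>2 + \<epsilon> * n\<^sup>2) / 2" .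
      have half: "x \<le> y / 2" if "2 * x \<le> y" for x y :: real using that by simp
      show ?thesis unfolding n_def[symmetric] eq by (rule half[OF fin_le])
    qed
  qed (rule \<gamma>)
qed

section \<open>Graphs of girth five with small independence number\<close>

text \<open>Girth at least five. The alternative \<open>x = z \<or> y = w\<close> exempts closed
  walks of length four that are not cycles.\<close>

definition girth5 :: "('a \<Rightarrow> 'a \<Rightarrow> bool) \<Rightarrow> bool" where
  "girth5 r \<longleftrightarrow> (\<forall>x y. r x y \<longrightarrow> r y x) \<and> (\<forall>x. \<not> r x x) \<and>
     (\<forall>x y z. r x y \<longrightarrow> r y z \<longrightarrow> \<not> r z x) \<and>
     (\<forall>x y z w. r x y \<longrightarrow> r y z \<longrightarrow> r z w \<longrightarrow> r w x \<longrightarrow> x = z \<or> y = w)"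

definition add_edge :: "'a \<Rightarrow> 'a \<Rightarrow> ('a \<Rightarrow> 'a \<Rightarrow> bool) \<Rightarrow> 'a \<Rightarrow> 'a \<Rightarrow> bool" where
  "add_edge a b r x y \<longleftrightarrow> r x y \<or> (x = a \<and> y = b) \<or> (x = b \<and> y = a)"

text \<open>A new triangle or 4-cycle would use the new edge, and the rest of it would be an old
  path of length two or three from \<open>a\<close> to \<open>b\<close>.\<close>

lemma girth5_add_edge:
  assumes "girth5 r" and ab: "a \<noteq> b" and "\<And>x. \<not> (r a x \<and> r x b)" and "\<And>x y. \<not> (r a x \<and> r x y \<and> r y b)"
  shows "girth5 (add_edge a b r)"
proof -
  define r' where "r' = add_edge a b r"
  have r: "\<And>x y. r x y \<Longrightarrow> r y x" "\<And>x. \<not> r x x" "\<And>x y z. r x y \<Longrightarrow> r y z \<Longrightarrow> \<not> r z x"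
    "\<And>x y z w. r x y \<Longrightarrow> r y z \<Longrightarrow> r z w \<Longrightarrow> r w x \<Longrightarrow> x = z \<or> y = w"
    using assms(1) unfolding girth5_def by blast+
  have r': "r' x y \<longleftrightarrow> r x y \<or> {x, y} = {a, b}" for x y
    by (auto simp: r'_def add_edge_def doubleton_eq_iff)
  define new where "new x y \<longleftrightarrow> {x, y} = {a, b}" for x y
  have r'_new: "r' x y \<Longrightarrow> r x y \<or> new x y" for x y by (simp add: r' new_def)
  have irr: "\<not> r' x x" for x using r(2) ab by (auto simp: r')
  have short: "\<not> (r c x \<and> r x e)" "\<not> (r c x \<and> r x y \<and> r y e)" if "{c, e} = {a, b}" for c e x y
    using that assms(3,4) r(1) unfolding doubleton_eq_iff by blast+
  have eqs: "{c, z} = {c, e} \<Longrightarrow> z = e" "{z, c} = {c, e} \<Longrightarrow> z = e" for c e z :: 'a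
    by (auto simp: doubleton_eq_iff)
  \<comment> \<open>The cycle is rotated to start with the new edge. Its other sides are then old,
    since its vertices are distinct.\<close>
  have tri: False if new': "new c e" and t: "r' e z" "r' z c" for c e z
  proof -
    have new: "{c, e} = {a, b}" using new' by (simp add: new_def)
    have "c \<noteq> z" "e \<noteq> z" using t irr by auto
    then have "r e z" "r z c" using t new by (auto simp: r' doubleton_eq_iff)
    then show False using short(1)[OF new] r(1) by blast
  qed
  have quad: False if new': "new c e" and t: "r' e z" "r' z w" "r' w c" "c \<noteq> z" "e \<noteq> w" for c e z w
  proof -
    have new: "{c, e} = {a, b}" using new' by (simp add: new_def)
    have "e \<noteq> z" "c \<noteq> w" using t irr by auto
    then have "r e z" "r z w" "r w c" using t new by (auto simp: r' doubleton_eq_iff)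
    then show False using short(2)[OF new] r(1) by blast
  qed
  show ?thesis unfolding girth5_def r'_def[symmetric]
  proof (intro conjI allI impI)
    fix x y z assume t: "r' x y" "r' y z"
    show "\<not> r' z x"
    proof
      assume t': "r' z x"
      show False
      proof (cases "r x y \<and> r y z \<and> r z x")
        case True then show False using r(3) by blast
      next
        case False
        then have "new x y \<or> new y z \<or> new z x"
          using r'_new[OF t(1)] r'_new[OF t(2)] r'_new[OF t'] by blast
        then show False
          using tri[OF _ t(2) t'] tri[OF _ t' t(1)] tri[OF _ t] by (elim disjE)
      qed
    qed
  next
    fix x y z w assume t: "r' x y" "r' y z" "r' z w" "r' w x"
    show "x = z \<or> y = w"
    proof (cases "r x y \<and> r y z \<and> r z w \<and> r w x")
      case True then show ?thesis using r(4) by blast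
    next
      case False
      then have "new x y \<or> new y z \<or> new z w \<or> new w x"
        using r'_new[OF t(1)] r'_new[OF t(2)] r'_new[OF t(3)] r'_new[OF t(4)] by blast
      then show ?thesis
        using quad[OF _ t(2,3,4)] quad[OF _ t(3,4,1)] quad[OF _ t(4,1,2)] quad[OF _ t(1,2,3)]
        by (elim disjE) blast+
    qed
  next
    show "r' y x" if "r' x y" for x y using that r(1) by (auto simp: r' insert_commute)
  qed (rule irr)
qed

lemma card_insert_le_Suc: "card (insert x A) \<le> Suc (card A)"
  by (cases "finite A") (auto simp: card_insert_if)

definition big_indep :: "nat \<Rightarrow> real \<Rightarrow> (nat \<Rightarrow> nat \<Rightarrow> bool) \<Rightarrow> nat set set" where
  "big_indep N \<gamma> r = {I. I \<subseteq> {..<N} \<and> \<gamma> * real N \<le> real (card I) \<and> (\<forall>x\<in>I. \<forall>y\<in>I. \<not> r x y)}"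

lemma finite_big_indep: "finite (big_indep N \<gamma> r)"
  by (rule finite_subset[of _ "Pow {..<N}"]) (auto simp: big_indep_def)

lemma popular_new_edge:
  fixes \<gamma> :: real
  assumes \<gamma>: "0 < \<gamma>" and dom: "\<And>x y. r x y \<Longrightarrow> x < N \<and> y < N" and r: "girth5 r"
    and deg: "\<And>x. card {y. r x y} \<le> D"
    and edges: "real (card (pairs r {..<N} {..<N})) \<le> 2 * C * real N"
    and D: "4 * C \<le> \<gamma> * real D" "D \<ge> 1" and N: "8 * (real D + 1) ^ 3 \<le> \<gamma>\<^sup>2 * real N" "N \<ge> 1"
    and ne: "big_indep N \<gamma> r \<noteq> {}"
  shows "\<exists>a<N. \<exists>b<N. card {y. r a y} < D \<and> card {y. r b y} < D \<and> girth5 (add_edge a b r) \<and>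
    \<gamma>\<^sup>2 / 8 * real (card (big_indep N \<gamma> r)) \<le> real (card {I \<in> big_indep N \<gamma> r. a \<in> I \<and> b \<in> I})"
proof -
  define S where "S = {x. x < N \<and> D \<le> card {y. r x y}}"
  define nb where "nb x = insert x {y. r x y}" for x
  \<comment> \<open>As \<open>nb\<close> is the closed neighbourhood, this covers all distances from
    0 to 3; excluding it also ensures \<open>a \<noteq> b\<close>.\<close>
  define close where "close x y \<longleftrightarrow> y \<in> (\<Union>u\<in>nb x. \<Union>v\<in>nb u. nb v)" for x y
  define Q where "Q = pairs close {..<N} {..<N}"
  have fnb: "finite {y. r x y}" for x by (rule finite_subset[of _ "{..<N}"]) (use dom in auto)
  have S: "real (card S) \<le> \<gamma> * real N / 2"
  proof -
    have "real D * real (card S) = (\<Sum>x\<in>S. real D)" by simp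
    also have "\<dots> \<le> (\<Sum>x\<in>S. real (card {y. r x y}))" by (intro sum_mono) (auto simp: S_def)
    also have "\<dots> \<le> (\<Sum>x<N. real (card {y. r x y}))" by (rule sum_mono2) (auto simp: S_def)
    also have "\<dots> = (\<Sum>x<N. real (card {y \<in> {..<N}. r x y}))"
      using dom by (intro sum.cong refl arg_cong[where f = "\<lambda>A. real (card A)"]) auto
    also have "\<dots> = real (card (pairs r {..<N} {..<N}))" by (simp add: card_pairs)
    also have "\<dots> \<le> 2 * C * real N" by (rule edges)
    also have "\<dots> \<le> \<gamma> * real D / 2 * real N" using D(1) by (intro mult_right_mono) auto
    finally have "real D * real (card S) \<le> real D * (\<gamma> * real N / 2)" by (simp add: mult_ac)
    then show ?thesis using D(2) by simp
  qed
  have cnb: "card (nb x) \<le> D + 1" for x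
    using deg[of x] fnb[of x] by (simp add: nb_def card_insert_if)
  have fnb': "finite (nb x)" for x using fnb by (simp add: nb_def)
  have Q: "real (card Q) \<le> \<gamma>\<^sup>2 / 8 * (real N)\<^sup>2"
  proof -
    have UN: "card (\<Union>u\<in>nb x. G u) \<le> (D + 1) * m" if "\<And>u. card (G u) \<le> m" for x m and G :: "nat \<Rightarrow> nat set"
    proof -
      have "card (\<Union>u\<in>nb x. G u) \<le> (\<Sum>u\<in>nb x. card (G u))" by (rule card_UN_le[OF fnb'])
      also have "\<dots> \<le> card (nb x) * m" using sum_bounded_above[of "nb x" "\<lambda>u. card (G u)" m] that by simp
      also have "\<dots> \<le> (D + 1) * m" using cnb by (rule mult_right_mono) simp
      finally show ?thesis .
    qed
    have ball: "card (\<Union>u\<in>nb x. \<Union>v\<in>nb u. nb v) \<le> (D + 1) * ((D + 1) * (D + 1))" for x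
      by (intro UN cnb)
    have "real (card Q) \<le> real (card {..<N}) * (real D + 1) ^ 3"
      unfolding Q_def
    proof (rule card_pairs_le)
      fix x
      have "card {y \<in> {..<N}. close x y} \<le> card (\<Union>u\<in>nb x. \<Union>v\<in>nb u. nb v)"
        using fnb' by (intro card_mono) (auto simp: close_def)
      also note ball
      also have "(D + 1) * ((D + 1) * (D + 1)) = (D + 1) ^ 3" by (simp add: power3_eq_cube)
      finally have "real (card {y \<in> {..<N}. close x y}) \<le> real ((D + 1) ^ 3)" by (rule of_nat_mono)
      then show "real (card {y \<in> {..<N}. close x y}) \<le> (real D + 1) ^ 3" by (simp add: add.commute)
    qed auto
    also have "\<dots> \<le> real N * (\<gamma>\<^sup>2 * real N / 8)"
      unfolding card_lessThan by (rule mult_left_mono) (use N(1) in auto)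
    finally show ?thesis by (simp add: power2_eq_square mult_ac)
  qed
  define H where "H I = (I - S) \<times> (I - S) - Q" for I
  define F where "F = big_indep N \<gamma> r"
  have finF: "finite F" by (simp add: F_def finite_big_indep)
  have "\<exists>ab\<in>{..<N} \<times> {..<N}. \<gamma>\<^sup>2 / 8 * real (card F) \<le> real (card {I \<in> F. ab \<in> H I})"
  proof (rule popular_point[OF _ _ finF])
    fix I assume "I \<in> F"
    then have I: "I \<subseteq> {..<N}" "\<gamma> * real N \<le> real (card I)" by (auto simp: F_def big_indep_def)
    then show "H I \<subseteq> {..<N} \<times> {..<N}" by (auto simp: H_def)
    have finI: "finite I" using I(1) finite_subset by blast
    have finS: "finite S" by (simp add: S_def)
    have "card I - card S \<le> card (I - S)" by (rule diff_card_le_card_Diff[OF finS])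
    then have IS: "\<gamma> * real N / 2 \<le> real (card (I - S))" using I(2) S by linarith
    have "\<gamma>\<^sup>2 / 4 * (real N)\<^sup>2 = (\<gamma> * real N / 2)\<^sup>2" by (simp add: power2_eq_square)
    also have "\<dots> \<le> (real (card (I - S)))\<^sup>2" using IS \<gamma> by (intro power_mono) auto
    also have "\<dots> = real (card ((I - S) \<times> (I - S)))" by (simp add: card_cartesian_product power2_eq_square)
    finally have "\<gamma>\<^sup>2 / 4 * (real N)\<^sup>2 \<le> real (card ((I - S) \<times> (I - S)))" .
    moreover have "card ((I - S) \<times> (I - S)) - card Q \<le> card (H I)"
      unfolding H_def by (rule diff_card_le_card_Diff) (simp add: Q_def)
    ultimately have "\<gamma>\<^sup>2 / 4 * (real N)\<^sup>2 - \<gamma>\<^sup>2 / 8 * (real N)\<^sup>2 \<le> real (card (H I))"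
      using Q by linarith
    then show "\<gamma>\<^sup>2 / 8 * real (card ({..<N} \<times> {..<N})) \<le> real (card (H I))"
      by (simp add: card_cartesian_product power2_eq_square)
  qed (use N(2) in \<open>auto simp: lessThan_empty_iff\<close>)
  then obtain a b where ab: "a < N" "b < N" "\<gamma>\<^sup>2 / 8 * real (card F) \<le> real (card {I \<in> F. (a, b) \<in> H I})"
    by auto
  \<comment> \<open>Positivity yields an actual set \<open>I\<close> with
    \<open>(a, b) \<in> H I\<close>, and this is what certifies that the pair is permitted.\<close>
  have "0 < \<gamma>\<^sup>2 / 8 * real (card F)" using \<gamma> ne finF by (simp add: F_def card_gt_0_iff)
  with ab(3) have "card {I \<in> F. (a, b) \<in> H I} \<noteq> 0" by linarith
  then obtain I where I: "I \<in> F" "(a, b) \<in> H I" by (metis (no_types, lifting) card.empty empty_Collect_eq)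
  then have S': "a \<notin> S" "b \<notin> S" and "(a, b) \<notin> Q" by (auto simp: H_def)
  then have nclose: "b \<notin> (\<Union>u\<in>nb a. \<Union>v\<in>nb u. nb v)" using ab by (simp add: Q_def pairs_def close_def)
  have self: "x \<in> nb x" for x by (simp add: nb_def)
  have step: "r x y \<Longrightarrow> y \<in> nb x" for x y by (simp add: nb_def)
  have "girth5 (add_edge a b r)"
  proof (rule girth5_add_edge[OF r])
    show "a \<noteq> b" using nclose self by blast
    show "\<not> (r a x \<and> r x b)" for x using nclose self step by blast
    show "\<not> (r a x \<and> r x y \<and> r y b)" for x y using nclose step by blast
  qed
  moreover have "card {I \<in> F. (a, b) \<in> H I} \<le> card {I \<in> F. a \<in> I \<and> b \<in> I}"
    using finF by (intro card_mono) (auto simp: H_def)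
  ultimately show ?thesis using ab S' unfolding S_def F_def[symmetric]
    by (intro exI[of _ a] exI[of _ b] conjI) auto
qed

text \<open>There are at most \<open>2 ^ N\<close> large independent sets at the start, and each
  round removes a fraction \<open>c\<close> of them. After \<open>C * N\<close> rounds fewer than
  one is left. The constants \<open>C\<close> and \<open>D\<close> are fixed before
  \<open>N\<close>, so the average degree stays bounded while \<open>N\<close> outgrows
  \<open>D ^ 3\<close>.\<close>

lemma girth5_small_indep:
  fixes \<gamma> :: real
  assumes "0 < \<gamma>" "\<gamma> \<le> 1"
  shows "\<exists>N r. N \<ge> 1 \<and> girth5 r \<and>
    (\<forall>I \<subseteq> {..<N::nat}. (\<forall>x\<in>I. \<forall>y\<in>I. \<not> r x y) \<longrightarrow> real (card I) < \<gamma> * real N)"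
proof -
  define c where "c = \<gamma>\<^sup>2 / 8"
  have c: "0 < c" "c \<le> 1" using assms power_le_one[of \<gamma> 2] by (auto simp: c_def)
  obtain C :: nat where C: "2 / c \<le> real C" using real_arch_simple by blast
  obtain D :: nat where D: "max 1 (4 * real C / \<gamma>) \<le> real D" using real_arch_simple by blast
  obtain N :: nat where N: "max 1 (8 * (real D + 1) ^ 3 / \<gamma>\<^sup>2) \<le> real N" using real_arch_simple by blast
  have D': "4 * real C \<le> \<gamma> * real D" "D \<ge> 1"
    using D assms by (auto simp: field_simps)
  have N': "8 * (real D + 1) ^ 3 \<le> \<gamma>\<^sup>2 * real N" "N \<ge> 1"
    using N assms by (auto simp: field_simps)
  have "\<exists>r. girth5 r \<and> (\<forall>x y. r x y \<longrightarrow> x < N \<and> y < N) \<and> (\<forall>x. card {y. r x y} \<le> D) \<and>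
      card (pairs r {..<N} {..<N}) \<le> 2 * t \<and> real (card (big_indep N \<gamma> r)) \<le> 2 ^ N * (1 - c) ^ t"
    if "t \<le> C * N" for t
    using that
  proof (induction t)
    case 0
    have "card (big_indep N \<gamma> (\<lambda>_ _. False)) \<le> card (Pow {..<N})"
      by (intro card_mono) (auto simp: big_indep_def)
    then have "real (card (big_indep N \<gamma> (\<lambda>_ _. False))) \<le> real (2 ^ N)"
      unfolding of_nat_le_iff by (simp add: card_Pow)
    then have "real (card (big_indep N \<gamma> (\<lambda>_ _. False))) \<le> 2 ^ N" by simp
    then show ?case by (intro exI[of _ "\<lambda>_ _. False"]) (simp add: girth5_def pairs_def)
  next
    case (Suc t)
    then obtain r where r: "girth5 r" "\<And>x y. r x y \<Longrightarrow> x < N \<and> y < N" "\<And>x. card {y. r x y} \<le> D"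
      "card (pairs r {..<N} {..<N}) \<le> 2 * t" "real (card (big_indep N \<gamma> r)) \<le> 2 ^ N * (1 - c) ^ t"
      by auto
    have "0 \<le> 2 ^ N * (1 - c) ^ Suc t" using c by simp
    show ?case
    \<comment> \<open>If no large independent set is left, the graph is kept; \<open>t\<close>
      counts rounds and only bounds the number of edges.\<close>
    proof (cases "big_indep N \<gamma> r = {}")
      case True
      then show ?thesis using r \<open>0 \<le> 2 ^ N * (1 - c) ^ Suc t\<close>
        by (intro exI[of _ r] conjI allI impI) auto
    next
      case False
      have "2 * t \<le> 2 * (C * N)" using Suc.prems by simp
      then have "card (pairs r {..<N} {..<N}) \<le> 2 * (C * N)" using r(4) by linarith
      then have "real (card (pairs r {..<N} {..<N})) \<le> real (2 * (C * N))" by (rule of_nat_mono)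
      then have e: "real (card (pairs r {..<N} {..<N})) \<le> 2 * real C * real N" by simp
      obtain a b where ab: "a < N" "b < N" "card {y. r a y} < D" "card {y. r b y} < D" "girth5 (add_edge a b r)"
        "c * real (card (big_indep N \<gamma> r)) \<le> real (card {I \<in> big_indep N \<gamma> r. a \<in> I \<and> b \<in> I})"
        using popular_new_edge[OF assms(1) r(2) r(1) r(3) e D' N' False] unfolding c_def by blast
      let ?r = "add_edge a b r"
      have "card {y. ?r x y} \<le> D" for x
      proof -
        have fx: "finite {y. r x y}" by (rule finite_subset[of _ "{..<N}"]) (use r(2) in auto)
        consider "x = a" | "x = b" | "x \<noteq> a" "x \<noteq> b" by blast
        then show ?thesis
        proof cases
          case 1
          have "{y. ?r x y} \<subseteq> insert b {y. r x y}" using 1 by (auto simp: add_edge_def)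
          then have "card {y. ?r x y} \<le> card (insert b {y. r x y})" using fx by (intro card_mono) auto
          also have "\<dots> \<le> Suc (card {y. r x y})" by (rule card_insert_le_Suc)
          finally show ?thesis using ab(3) 1 by simp
        next
          case 2
          have "{y. ?r x y} \<subseteq> insert a {y. r x y}" using 2 by (auto simp: add_edge_def)
          then have "card {y. ?r x y} \<le> card (insert a {y. r x y})" using fx by (intro card_mono) auto
          also have "\<dots> \<le> Suc (card {y. r x y})" by (rule card_insert_le_Suc)
          finally show ?thesis using ab(4) 2 by simp
        next
          case 3
          then show ?thesis using r(3)[of x] by (simp add: add_edge_def)
        qed
      qed
      moreover have "card (pairs ?r {..<N} {..<N}) \<le> 2 * Suc t"
      proof -
        have "pairs ?r {..<N} {..<N} \<subseteq> insert (a, b) (insert (b, a) (pairs r {..<N} {..<N}))"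
          unfolding pairs_def add_edge_def by blast
        then have "card (pairs ?r {..<N} {..<N}) \<le> card (insert (a, b) (insert (b, a) (pairs r {..<N} {..<N})))"
          by (intro card_mono) auto
        also have "\<dots> \<le> Suc (card (insert (b, a) (pairs r {..<N} {..<N})))" by (rule card_insert_le_Suc)
        also have "\<dots> \<le> Suc (Suc (card (pairs r {..<N} {..<N})))" unfolding Suc_le_mono by (rule card_insert_le_Suc)
        finally show ?thesis using r(4) by simp
      qed
      moreover have "real (card (big_indep N \<gamma> ?r)) \<le> 2 ^ N * (1 - c) ^ Suc t"
      proof -
        let ?B = "{I \<in> big_indep N \<gamma> r. a \<in> I \<and> b \<in> I}"
        have "big_indep N \<gamma> ?r \<subseteq> big_indep N \<gamma> r - ?B"
          unfolding big_indep_def add_edge_def by blast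
        then have "card (big_indep N \<gamma> ?r) \<le> card (big_indep N \<gamma> r - ?B)"
          by (intro card_mono finite_Diff finite_big_indep)
        also have "\<dots> = card (big_indep N \<gamma> r) - card ?B"
          by (intro card_Diff_subset) (auto intro: finite_subset[OF _ finite_big_indep])
        finally have "card (big_indep N \<gamma> ?r) \<le> card (big_indep N \<gamma> r) - card ?B" .
        moreover have "card ?B \<le> card (big_indep N \<gamma> r)" by (intro card_mono finite_big_indep) auto
        ultimately have "real (card (big_indep N \<gamma> ?r)) \<le> real (card (big_indep N \<gamma> r)) - real (card ?B)"
          by linarith
        also have "\<dots> \<le> (1 - c) * real (card (big_indep N \<gamma> r))" using ab(6) by (simp add: algebra_simps)
        also have "\<dots> \<le> (1 - c) * (2 ^ N * (1 - c) ^ t)" using r(5) c by (intro mult_left_mono) auto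
        finally show ?thesis by (simp add: mult_ac)
      qed
      moreover have "?r x y \<Longrightarrow> x < N \<and> y < N" for x y using r(2) ab(1,2) by (auto simp: add_edge_def)
      ultimately show ?thesis using ab(5) by (intro exI[of _ ?r]) blast
    qed
  qed
  from this[OF order_refl] obtain r where r: "girth5 r"
    "real (card (big_indep N \<gamma> r)) \<le> 2 ^ N * (1 - c) ^ (C * N)" by blast
  \<comment> \<open>The choice of \<open>C\<close> makes this at most \<open>exp (- 2)\<close>, less
    than the 1/2 needed to beat \<open>2 ^ N\<close>.\<close>
  have "(1 - c) ^ C \<le> exp (- c) ^ C"
    using c exp_ge_add_one_self[of "- c"] by (intro power_mono) auto
  also have "\<dots> = exp (- (c * real C))" by (simp add: exp_of_nat_mult[symmetric] mult.commute)
  also have "\<dots> \<le> exp (- 2)" using C c by (simp add: field_simps)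
  also have "\<dots> = 1 / exp 2" by (simp add: exp_minus inverse_eq_divide)
  also have "\<dots> \<le> 1 / 3" using exp_ge_add_one_self[of 2] by (intro divide_left_mono) auto
  finally have small: "(1 - c) ^ C \<le> 1 / 3" .
  have "2 ^ N * (1 - c) ^ (C * N) = (2 * (1 - c) ^ C) ^ N" by (simp add: power_mult power_mult_distrib)
  also have "\<dots> \<le> (2 * (1 - c) ^ C) ^ 1" using small c N'(2) by (intro power_decreasing) auto
  also have "\<dots> < 1" using small by simp
  finally have "real (card (big_indep N \<gamma> r)) < 1" using r(2) by linarith
  then have "big_indep N \<gamma> r = {}" using finite_big_indep[of N \<gamma> r] by simp
  then show ?thesis using r(1) N'(2)
    by (intro exI[of _ N] exI[of _ r]) (auto simp: big_indep_def not_le)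
qed

section \<open>Joins of sparse graphs\<close>

text \<open>A vertex x lies in part x mod q; within its part it has index x div q, which is position
  x div q mod k of copy x div q div k of the graph r on {..<k}.\<close>

definition join_adj :: "nat \<Rightarrow> nat \<Rightarrow> (nat \<Rightarrow> nat \<Rightarrow> bool) \<Rightarrow> nat \<Rightarrow> nat \<Rightarrow> bool" where
  "join_adj q k r x y \<longleftrightarrow> x mod q \<noteq> y mod q \<or>
     (x div q div k = y div q div k \<and> r (x div q mod k) (y div q mod k))"

definition join_graph :: "nat \<Rightarrow> nat \<Rightarrow> (nat \<Rightarrow> nat \<Rightarrow> bool) \<Rightarrow> nat \<Rightarrow> nat set set" where
  "join_graph q k r n = {{x, y} | x y. x < n \<and> y < n \<and> join_adj q k r x y}"

lemma block_coordinates_eqI: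
  fixes x y q k :: nat
  assumes "x mod q = y mod q" "x div q div k = y div q div k" "x div q mod k = y div q mod k"
  shows "x = y"
proof -
  have "x div q = y div q" using assms(2,3) by (metis div_mult_mod_eq)
  then show ?thesis using assms(1) by (metis div_mult_mod_eq)
qed

context
  fixes q k :: nat and r :: "nat \<Rightarrow> nat \<Rightarrow> bool"
  assumes r: "girth5 r"
begin

lemma girth5_sym: "r x y \<Longrightarrow> r y x" and girth5_irrefl: "\<not> r x x" and girth5_no_triangle: "r x y \<Longrightarrow> r y z \<Longrightarrow> \<not> r z x"
  and girth5_no_C4: "r x y \<Longrightarrow> r y z \<Longrightarrow> r z w \<Longrightarrow> r w x \<Longrightarrow> x = z \<or> y = w"
  using r unfolding girth5_def by blast+

lemma join_adj_sym: "join_adj q k r x y \<longleftrightarrow> join_adj q k r y x"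
  using girth5_sym by (auto simp: join_adj_def)

lemma join_adj_irr: "\<not> join_adj q k r x x"
  using girth5_irrefl by (auto simp: join_adj_def)

lemma in_join_graph: "{x, y} \<in> join_graph q k r n \<longleftrightarrow> x < n \<and> y < n \<and> join_adj q k r x y"
proof
  assume "{x, y} \<in> join_graph q k r n"
  then obtain a b where ab: "{x, y} = {a, b}" "a < n" "b < n" "join_adj q k r a b"
    by (auto simp: join_graph_def)
  from ab(1) have "x = a \<and> y = b \<or> x = b \<and> y = a" by (simp add: doubleton_eq_iff)
  then show "x < n \<and> y < n \<and> join_adj q k r x y" using ab(2-4) join_adj_sym by auto
qed (auto simp: join_graph_def)

lemma simple_join_graph: "simple_graph {..<n} (join_graph q k r n)"
proof -
  have "{x, y} \<in> [{..<n}]\<^bsup>2\<^esup>" if "x < n" "y < n" "join_adj q k r x y" for x y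
    using that join_adj_irr[of x] by (cases "x = y") (auto simp: nsets_def)
  then show ?thesis by (auto simp: simple_graph_def join_graph_def)
qed

lemma card_residue_class:
  assumes "q \<ge> 1"
  shows "card {y. y < n \<and> y mod q = a} \<le> n div q + 1"
proof -
  have "inj_on (\<lambda>y. y div q) {y. y < n \<and> y mod q = a}"
    by (rule inj_onI) (metis (mono_tags, lifting) div_mult_mod_eq mem_Collect_eq)
  then have "card {y. y < n \<and> y mod q = a} \<le> card {..n div q}"
    by (rule card_inj_on_le) (auto intro: div_le_mono)
  then show ?thesis by simp
qed

text \<open>Only edges between different parts are counted: a vertex is adjacent to everything
  outside its residue class, and the \<open>- 1\<close> allows for rounding in the size of that
  class.\<close>

lemma join_graph_edges:
  assumes "q \<ge> 1"
  shows "real n * (real n - real n / real q - 1) / 2 \<le> real (card (join_graph q k r n))"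
proof -
  have deg: "real n - real n / real q - 1 \<le> real (card {y \<in> {..<n}. {x, y} \<in> join_graph q k r n})"
    if x: "x < n" for x
  proof -
    have "{..<n} - {y. y < n \<and> y mod q = x mod q} \<subseteq> {y \<in> {..<n}. {x, y} \<in> join_graph q k r n}"
      using x by (auto simp: in_join_graph join_adj_def)
    then have "card ({..<n} - {y. y < n \<and> y mod q = x mod q}) \<le> card {y \<in> {..<n}. {x, y} \<in> join_graph q k r n}"
      by (intro card_mono) auto
    moreover have "card {..<n} - card {y. y < n \<and> y mod q = x mod q} \<le> card ({..<n} - {y. y < n \<and> y mod q = x mod q})"
      by (rule diff_card_le_card_Diff) simp
    ultimately have "real n - real (n div q + 1) \<le> real (card {y \<in> {..<n}. {x, y} \<in> join_graph q k r n})"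
      using card_residue_class[OF assms, of n "x mod q"] unfolding card_lessThan by linarith
    moreover have "real (n div q) \<le> real n / real q" by (rule of_nat_div_le_of_nat)
    ultimately show ?thesis by linarith
  qed
  have "real n * (real n - real n / real q - 1) \<le> (\<Sum>x<n. real (card {y \<in> {..<n}. {x, y} \<in> join_graph q k r n}))"
    using sum_bounded_below[of "{..<n}" "real n - real n / real q - 1"] deg by simp
  also have "\<dots> = real (card (pairs (\<lambda>x y. {x, y} \<in> join_graph q k r n) {..<n} {..<n}))"
    by (simp add: card_pairs)
  also have "\<dots> = 2 * real (card (join_graph q k r n))"
    using card_arcs[OF simple_join_graph[of n]] by simp
  finally show ?thesis by simp
qed

text \<open>Three clique vertices in one part would lie in the same copy and form a triangle of
  \<open>r\<close>; so each part holds at most two.\<close>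

lemma join_graph_clique_free:
  assumes "q \<ge> 1"
  shows "clique_free {..<n} (join_graph q k r n) (2 * q + 1)"
  unfolding clique_free_def
proof safe
  fix K assume K: "K \<subseteq> {..<n}" "card K = 2 * q + 1" "clique K (join_graph q k r n)"
  have finK: "finite K" using K(1) finite_subset by blast
  have two: "card {x \<in> K. x mod q = i} \<le> 2" for i
  proof (rule ccontr)
    assume "\<not> ?thesis"
    then have "3 \<le> card {x \<in> K. x mod q = i}" by simp
    then obtain T where T: "T \<subseteq> {x \<in> K. x mod q = i}" "card T = 3"
      by (rule obtain_subset_with_card_n)
    from T(2) obtain x y z where xyz: "T = {x, y, z}" "x \<noteq> y" "x \<noteq> z" "y \<noteq> z" by (auto simp: card_3_iff)
    have "r (u div q mod k) (v div q mod k)" if "u \<in> T" "v \<in> T" "u \<noteq> v" for u v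
    proof -
      have "u \<in> K" "v \<in> K" "u mod q = v mod q" using that(1,2) T(1) by auto
      moreover from this have "join_adj q k r u v" using K(3) that(3) by (auto simp: clique_def in_join_graph)
      ultimately show ?thesis by (simp add: join_adj_def)
    qed
    then have "r (x div q mod k) (y div q mod k)" "r (y div q mod k) (z div q mod k)" "r (z div q mod k) (x div q mod k)"
      using xyz by auto
    then show False using girth5_no_triangle by blast
  qed
  have "K = (\<Union>i<q. {x \<in> K. x mod q = i})" using assms by auto
  then have "card K \<le> (\<Sum>i<q. card {x \<in> K. x mod q = i})"
    using card_UN_le[of "{..<q}" "\<lambda>i. {x \<in> K. x mod q = i}"] by simp
  also have "\<dots> \<le> 2 * q" using sum_bounded_above[of "{..<q}" "\<lambda>i. card {x \<in> K. x mod q = i}" 2] two by simp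
  finally show False using K(2) by simp
qed

text \<open>The trace of a vertex contains all of the shattered set outside the part of the vertex. The
  empty trace therefore confines the set to one part, and traces of size three of a four-element
  set come from vertices in that part.\<close>

lemma join_graph_shattered:
  assumes S: "shattered {..<n} (join_graph q k r n) S"
  shows "card S \<le> 3"
proof (rule ccontr)
  assume "\<not> ?thesis"
  then have "Suc 3 \<le> card S" by simp
  then obtain T where T: "T \<subseteq> S" "card T = Suc 3"
    by (rule obtain_subset_with_card_n)
  from card_eq_SucD[OF T(2)] obtain a T' where T': "T = insert a T'" "a \<notin> T'" "card T' = 3"
    by blast
  then obtain b c e where bce: "T' = {b, c, e}" "b \<noteq> c" "b \<noteq> e" "c \<noteq> e" by (auto simp: card_3_iff)
  have mem: "a \<in> S" "b \<in> S" "c \<in> S" "e \<in> S" and ne: "a \<noteq> b" "a \<noteq> c" "a \<noteq> e"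
    using T(1) T' bce by auto
  have SV: "\<And>x. x \<in> S \<Longrightarrow> x < n" using S by (auto simp: shattered_def)
  have trace: "\<exists>v<n. \<forall>s\<in>S. join_adj q k r s v \<longleftrightarrow> s \<in> B" if "B \<subseteq> S" for B
  proof -
    have "\<exists>v\<in>{..<n}. neighbors {..<n} (join_graph q k r n) v \<inter> S = B"
      using S that unfolding shattered_def by simp
    then obtain v where v: "v < n" "neighbors {..<n} (join_graph q k r n) v \<inter> S = B" by auto
    have "join_adj q k r s v \<longleftrightarrow> s \<in> B" if s: "s \<in> S" for s
    proof -
      have "s \<in> B \<longleftrightarrow> s \<in> neighbors {..<n} (join_graph q k r n) v" using v(2) s by blast
      then show ?thesis using SV[OF s] v(1) by (simp add: neighbors_def in_join_graph)
    qed
    then show ?thesis using v(1) by blast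
  qed
  obtain v0 where v0: "\<forall>s\<in>S. \<not> join_adj q k r s v0" using trace[of "{}"] by auto
  have part: "x mod q = v0 mod q" if "x \<in> S" for x using v0 that by (auto simp: join_adj_def)
  \<comment> \<open>These two traces share \<open>a\<close> and \<open>b\<close>, so
    \<open>v\<close> and \<open>w\<close> become two common neighbours of \<open>a\<close> and
    \<open>b\<close>: a 4-cycle of \<open>r\<close>.\<close>
  obtain v where v: "\<forall>s\<in>S. join_adj q k r s v \<longleftrightarrow> s \<in> {a, b, c}"
    using trace[of "{a, b, c}"] mem by auto
  obtain w where w: "\<forall>s\<in>S. join_adj q k r s w \<longleftrightarrow> s \<in> {a, b, e}"
    using trace[of "{a, b, e}"] mem by auto
  \<comment> \<open>Each of \<open>v\<close> and \<open>w\<close> misses an element of the shattered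
    set, and vertices of different parts are always adjacent.\<close>
  have "\<not> join_adj q k r e v" "\<not> join_adj q k r c w" using v w mem bce ne by auto
  then have pv: "v mod q = v0 mod q" and pw: "w mod q = v0 mod q"
    using part mem by (auto simp: join_adj_def)
  have "join_adj q k r c v" "\<not> join_adj q k r c w" using v w mem bce ne by auto
  then have vw: "v \<noteq> w" by auto
  have "join_adj q k r a v" "join_adj q k r b v" "join_adj q k r a w" "join_adj q k r b w"
    using v w mem by auto
  then have adj: "a div q div k = v div q div k" "r (a div q mod k) (v div q mod k)"
    "b div q div k = v div q div k" "r (b div q mod k) (v div q mod k)"
    "a div q div k = w div q div k" "r (a div q mod k) (w div q mod k)"
    "r (b div q mod k) (w div q mod k)"
    using part[OF mem(1)] part[OF mem(2)] pv pw by (simp_all add: join_adj_def)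
  have "a div q mod k = b div q mod k \<or> v div q mod k = w div q mod k"
    using girth5_no_C4 adj girth5_sym by meson
  then have "a = b \<or> v = w"
    using block_coordinates_eqI[of a q b k] block_coordinates_eqI[of v q w k] part[OF mem(1)] part[OF mem(2)] pv pw adj by auto
  then show False using ne vw by simp
qed

lemma join_graph_vc_dim: "vc_dim {..<n} (join_graph q k r n) \<le> 3"
proof (cases "{card S | S. shattered {..<n} (join_graph q k r n) S} = {}")
  \<comment> \<open>This is the graph without vertices, where the supremum of the empty set is
    0.\<close>
  case True
  then show ?thesis by (simp add: vc_dim_def del: Collect_empty_eq)
next
  case False
  then show ?thesis unfolding vc_dim_def using join_graph_shattered by (intro cSup_least) auto
qed

text \<open>An independent set lies in one part and meets each copy of \<open>r\<close> in an
  independent set of \<open>r\<close>. A part has only about \<open>n / q\<close>, at most half, of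
  the vertices; the other half pays for charging an incomplete last copy at full size
  \<open>k\<close>, which is where \<open>n \<ge> 2 * k\<close> enters.\<close>

lemma join_graph_independence:
  fixes \<gamma> :: real
  assumes q: "q \<ge> 2" and k: "k \<ge> 1" and n: "n \<ge> 2 * k" and "\<gamma> > 0"
    and small: "\<And>I. I \<subseteq> {..<k} \<Longrightarrow> \<forall>x\<in>I. \<forall>y\<in>I. \<not> r x y \<Longrightarrow> real (card I) \<le> \<gamma> * real k"
  shows "real (independence_number {..<n} (join_graph q k r n)) \<le> \<gamma> * real n"
proof -
  have "real (card I) \<le> \<gamma> * real n" if I: "I \<subseteq> {..<n}" "indep I (join_graph q k r n)" for I
  proof -
    have finI: "finite I" using I(1) finite_subset by blast
    have nadj: "\<not> join_adj q k r x y" if "x \<in> I" "y \<in> I" for x y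
      using that I join_adj_irr[of x] unfolding indep_def
      by (cases "x = y") (auto simp: in_join_graph)
    have block: "real (card {x \<in> I. x div q div k = j}) \<le> \<gamma> * real k" for j
    proof -
      let ?f = "\<lambda>x. x div q mod k" and ?B = "{x \<in> I. x div q div k = j}"
      have "inj_on ?f ?B"
        by (rule inj_onI, rule block_coordinates_eqI[of _ q _ k]) (use nadj in \<open>auto simp: join_adj_def\<close>)
      then have "card ?B = card (?f ` ?B)" by (simp add: card_image)
      also have "real (card (?f ` ?B)) \<le> \<gamma> * real k"
        by (rule small) (use k nadj in \<open>auto simp: join_adj_def\<close>)
      finally show ?thesis .
    qed
    have "I = (\<Union>j\<in>{..n div q div k}. {x \<in> I. x div q div k = j})"
      using I(1) by (force intro!: div_le_mono)
    then have "card I \<le> (\<Sum>j\<in>{..n div q div k}. card {x \<in> I. x div q div k = j})"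
      using card_UN_le[of "{..n div q div k}" "\<lambda>j. {x \<in> I. x div q div k = j}"] by simp
    then have "real (card I) \<le> (\<Sum>j\<in>{..n div q div k}. real (card {x \<in> I. x div q div k = j}))"
      unfolding of_nat_sum[symmetric] of_nat_le_iff .
    also have "\<dots> \<le> (\<Sum>j\<in>{..n div q div k}. \<gamma> * real k)" by (intro sum_mono block)
    also have "\<dots> = \<gamma> * (real (n div q div k) * real k + real k)" by (simp add: algebra_simps)
    also have "\<dots> \<le> \<gamma> * real n"
    proof (rule mult_left_mono)
      have "n div q div k * k \<le> n div q" by (rule div_times_less_eq_dividend)
      also have "\<dots> \<le> n div 2" using q by (simp add: div_le_mono2)
      finally have "n div q div k * k \<le> n div 2" .
      moreover have "n div 2 * 2 \<le> n" by simp
      moreover have "x + y \<le> n" if "x \<le> z" "z * 2 \<le> n" "2 * y \<le> n" for x y z :: nat using that by simp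
      ultimately have "n div q div k * k + k \<le> n" using n by blast
      then show "real (n div q div k) * real k + real k \<le> real n"
        by (metis of_nat_add of_nat_le_iff of_nat_mult)
    qed (use \<open>\<gamma> > 0\<close> in simp)
    finally show ?thesis .
  qed
  moreover have "independence_number {..<n} (join_graph q k r n) \<in> {card I | I. I \<subseteq> {..<n} \<and> indep I (join_graph q k r n)}"
    unfolding independence_number_def
  proof (rule Max_in)
    have "{card I | I. I \<subseteq> {..<n} \<and> indep I (join_graph q k r n)} \<subseteq> card ` Pow {..<n}" by auto
    then show "finite {card I | I. I \<subseteq> {..<n} \<and> indep I (join_graph q k r n)}" by (rule finite_subset) simp
    have "indep {} (join_graph q k r n)" by (simp add: indep_def)
    then show "{card I | I. I \<subseteq> {..<n} \<and> indep I (join_graph q k r n)} \<noteq> {}" by blast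
  qed
  ultimately show ?thesis by auto
qed

end

section \<open>Asymptotics\<close>

lemma clique_free_mono:
  assumes "clique_free V E m" "m \<le> m'"
  shows "clique_free V E m'"
  unfolding clique_free_def
proof safe
  fix K assume K: "K \<subseteq> V" "m' = card K" "clique K E"
  then obtain L where "L \<subseteq> K" "card L = m"
    using assms(2) by (metis obtain_subset_with_card_n)
  then show False using assms(1) K unfolding clique_free_def clique_def by blast
qed

lemma RT_mono:
  assumes "m \<le> m'"
  shows "RT d n m a \<le> RT d n m' a"
  unfolding RT_def by (rule Sup_subset_mono) (use clique_free_mono[OF _ assms] in blast)

lemma RT_upper:
  fixes \<epsilon> :: real
  assumes "p \<ge> 2" "\<epsilon> > 0"
  shows "\<exists>\<gamma>0>0. \<forall>\<gamma>\<le>\<gamma>0. \<forall>n\<ge>1.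
    RT d n (2 * p) (\<gamma> * real n) / ereal (real n ^ 2) \<le> ereal (1 / 2 * (1 - 1 / (real p - 1)) + \<epsilon>)"
proof -
  define c where "c = 1 / 2 * (1 - 1 / (real p - 1)) + \<epsilon>"
  obtain \<gamma>0 where \<gamma>0: "\<gamma>0 > 0" "\<And>(V :: nat set) E. simple_graph V E \<Longrightarrow> V \<noteq> {} \<Longrightarrow> clique_free V E (2 * p) \<Longrightarrow>
    vc_dim V E \<le> d \<Longrightarrow> real (independence_number V E) \<le> \<gamma>0 * real (card V) \<Longrightarrow>
    real (card E) \<le> c * real (card V) ^ 2"
    using card_edges_le[OF assms, of d, where 'a = nat] unfolding c_def by blast
  have "RT d n (2 * p) (\<gamma> * real n) / ereal (real n ^ 2) \<le> ereal c" if "\<gamma> \<le> \<gamma>0" "n \<ge> 1" for \<gamma> n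
  proof -
    have "RT d n (2 * p) (\<gamma> * real n) \<le> ereal (c * real n ^ 2)"
      unfolding RT_def
    proof (rule Sup_least, clarify)
      fix V :: "nat set" and E
      assume G: "simple_graph V E" "n = card V" "clique_free V E (2 * p)" "vc_dim V E \<le> d"
        "real (independence_number V E) \<le> \<gamma> * real (card V)"
      have "\<gamma> * real (card V) \<le> \<gamma>0 * real (card V)" using that(1) by (rule mult_right_mono) simp
      then have "real (independence_number V E) \<le> \<gamma>0 * real (card V)" using G(5) by linarith
      then have "real (card E) \<le> c * real (card V) ^ 2" using G that(2) by (intro \<gamma>0(2)) auto
      then show "ereal (real (card E)) \<le> ereal (c * real (card V) ^ 2)" by simp
    qed
    then have "RT d n (2 * p) (\<gamma> * real n) / ereal (real n ^ 2) \<le> ereal (c * real n ^ 2) / ereal (real n ^ 2)"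
      by (rule ereal_divide_right_mono) (use that in simp)
    then show ?thesis using that(2) by simp
  qed
  then show ?thesis using \<gamma>0(1) unfolding c_def by blast
qed

text \<open>The error term is the rounding loss in \<open>join_graph_edges\<close> after division by
  the square of \<open>n\<close>.\<close>

lemma RT_lower:
  fixes \<gamma> :: real
  assumes "p \<ge> 3" "d \<ge> 3" "\<gamma> > 0"
  shows "\<exists>n0. \<forall>n\<ge>n0. ereal (1 / 2 * (1 - 1 / (real p - 1)) - 1 / 2 * (1 / real n)) \<le>
    RT d n (2 * p - 1) (\<gamma> * real n) / ereal (real n ^ 2)"
proof -
  define q where "q = p - 1"
  have q: "q \<ge> 2" "2 * p - 1 = 2 * q + 1" "real p - 1 = real q" using assms(1) by (auto simp: q_def of_nat_diff)
  \<comment> \<open>The minimum meets the requirement of \<open>girth5_small_indep\<close> that the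
    ratio be at most 1.\<close>
  obtain k r where k: "k \<ge> 1" and r: "girth5 r" and small:
    "\<And>I. I \<subseteq> {..<k::nat} \<Longrightarrow> \<forall>x\<in>I. \<forall>y\<in>I. \<not> r x y \<Longrightarrow> real (card I) < min 1 \<gamma> * real k"
    using girth5_small_indep[of "min 1 \<gamma>"] assms(3) by auto
  have small': "real (card I) \<le> \<gamma> * real k" if "I \<subseteq> {..<k}" "\<forall>x\<in>I. \<forall>y\<in>I. \<not> r x y" for I
  proof -
    have "min 1 \<gamma> * real k \<le> \<gamma> * real k" by (intro mult_right_mono) auto
    then show ?thesis using small[OF that] by linarith
  qed
  have "ereal (1 / 2 * (1 - 1 / real q) - 1 / 2 * (1 / real n)) \<le> RT d n (2 * q + 1) (\<gamma> * real n) / ereal (real n ^ 2)"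
    if n: "n \<ge> 2 * k" for n
  proof -
    have n1: "real n > 0" using n k by simp
    let ?E = "join_graph q k r n"
    have "vc_dim {..<n} ?E \<le> d" using join_graph_vc_dim[OF r, of n q k] assms(2) by linarith
    moreover have "clique_free {..<n} ?E (2 * q + 1)" using q(1) by (intro join_graph_clique_free r) simp
    moreover have "real (independence_number {..<n} ?E) \<le> \<gamma> * real n"
      by (rule join_graph_independence[OF r q(1) k n assms(3)]) (use small' in auto)
    ultimately have "ereal (real (card ?E)) \<le> RT d n (2 * q + 1) (\<gamma> * real n)"
      unfolding RT_def by (intro Sup_upper) (use simple_join_graph[OF r] in force)
    then have "ereal (real (card ?E)) / ereal (real n ^ 2) \<le> RT d n (2 * q + 1) (\<gamma> * real n) / ereal (real n ^ 2)"
      by (rule ereal_divide_right_mono) (use n1 in simp)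
    moreover have "1 / 2 * (1 - 1 / real q) - 1 / 2 * (1 / real n) \<le> real (card ?E) / real n ^ 2"
    proof -
      have "1 / 2 * (1 - 1 / real q) - 1 / 2 * (1 / real n) = (real n * (real n - real n / real q - 1) / 2) / real n ^ 2"
        using n1 by (simp add: field_simps power2_eq_square)
      also have "\<dots> \<le> real (card ?E) / real n ^ 2"
        by (rule divide_right_mono) (use join_graph_edges[OF r] q(1) in auto)
      finally show ?thesis .
    qed
    ultimately show ?thesis using n1 by (simp add: order_trans[rotated])
  qed
  then show ?thesis unfolding q by blast
qed

text \<open>The lower bound holds for each \<gamma> with an error vanishing in \<open>n\<close>, so
  already every \<open>liminf\<close> is at least \<open>c\<close>. The upper bound is uniform in
  \<open>n\<close> for small \<gamma> and confines the \<open>limsup\<close>; the comparison of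
  \<open>liminf\<close> with \<open>limsup\<close> squeezes both.\<close>

lemma RT_asymptoticI:
  assumes upper: "\<And>\<epsilon>. \<epsilon> > 0 \<Longrightarrow> \<exists>\<gamma>0>0. \<forall>\<gamma>\<le>\<gamma>0. \<forall>n\<ge>1.
      RT d n m (\<gamma> * real n) / ereal (real n ^ 2) \<le> ereal (c + \<epsilon>)"
    and lower: "\<And>\<gamma>. \<gamma> > 0 \<Longrightarrow> \<exists>n0. \<forall>n\<ge>n0. ereal (c - 1 / 2 * (1 / real n)) \<le>
      RT d n m (\<gamma> * real n) / ereal (real n ^ 2)"
  shows "RT_asymptotic d m c"
proof -
  define F where "F \<gamma> n = RT d n m (\<gamma> * real n) / ereal (real n ^ 2)" for \<gamma> n
  have "(\<lambda>n. c - 1 / 2 * (1 / real n)) \<longlonglongrightarrow> c - 1 / 2 * 0"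
    by (intro tendsto_intros lim_1_over_n)
  then have lim: "liminf (\<lambda>n. ereal (c - 1 / 2 * (1 / real n))) = ereal c"
    by (intro lim_imp_Liminf) auto
  have low: "ereal c \<le> liminf (F \<gamma>)" if "\<gamma> > 0" for \<gamma>
  proof -
    have "liminf (\<lambda>n. ereal (c - 1 / 2 * (1 / real n))) \<le> liminf (F \<gamma>)"
      by (rule Liminf_mono) (use lower[OF that] in \<open>auto simp: F_def eventually_sequentially\<close>)
    then show ?thesis by (simp only: lim)
  qed
  have le: "liminf (F \<gamma>) \<le> limsup (F \<gamma>)" for \<gamma> by (rule Liminf_le_Limsup) simp
  have up: "\<forall>\<^sub>F \<gamma> in at_right 0. limsup (F \<gamma>) < a" if a: "ereal c < a" for a
  proof -
    \<comment> \<open>A real bound strictly below \<open>a\<close> is needed, since \<open>a\<close>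
      may be infinite and the conclusion is strict.\<close>
    obtain z where z: "ereal c < ereal z" "ereal z < a" using ereal_dense2[OF a] by auto
    then obtain \<gamma>0 where \<gamma>0: "\<gamma>0 > 0" "\<And>\<gamma> n. \<gamma> \<le> \<gamma>0 \<Longrightarrow> n \<ge> 1 \<Longrightarrow> F \<gamma> n \<le> ereal z"
      using upper[of "z - c"] by (auto simp: F_def)
    have "limsup (F \<gamma>) < a" if "\<gamma> < \<gamma>0" for \<gamma>
    proof -
      have "limsup (F \<gamma>) \<le> ereal z"
        by (rule Limsup_bounded) (use \<gamma>0(2)[of \<gamma>] that in \<open>auto simp: eventually_sequentially intro: exI[of _ 1]\<close>)
      then show ?thesis using z(2) by simp
    qed
    then show ?thesis using \<gamma>0(1) by (auto simp: eventually_at_right_field)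
  qed
  have pos: "\<forall>\<^sub>F \<gamma> in at_right (0::real). \<gamma> > 0" by (simp add: eventually_at_right_less)
  have "((\<lambda>\<gamma>. limsup (F \<gamma>)) \<longlongrightarrow> ereal c) (at_right 0)"
  proof (rule order_tendstoI)
    show "\<forall>\<^sub>F \<gamma> in at_right 0. a < limsup (F \<gamma>)" if "a < ereal c" for a
      using pos by eventually_elim (use that low le in \<open>blast intro: less_le_trans order_trans\<close>)
  qed (rule up)
  moreover have "((\<lambda>\<gamma>. liminf (F \<gamma>)) \<longlongrightarrow> ereal c) (at_right 0)"
  proof (rule order_tendstoI)
    show "\<forall>\<^sub>F \<gamma> in at_right 0. a < liminf (F \<gamma>)" if "a < ereal c" for a
      using pos by eventually_elim (use that low in \<open>blast intro: less_le_trans\<close>)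
    show "\<forall>\<^sub>F \<gamma> in at_right 0. liminf (F \<gamma>) < a" if "ereal c < a" for a
      using up[OF that] by eventually_elim (use le in \<open>blast intro: le_less_trans\<close>)
  qed
  ultimately show ?thesis by (simp add: RT_asymptotic_def F_def[abs_def])
qed

theorem theorem5:
  fixes d p :: nat
  assumes "d \<ge> 4" and "p \<ge> 3"
  shows "RT_asymptotic d (2 * p - 1) (1 / 2 * (1 - 1 / (real p - 1))) \<and>
         RT_asymptotic d (2 * p) (1 / 2 * (1 - 1 / (real p - 1)))"
proof -
  \<comment> \<open>This transfers the upper bound for \<open>2 * p\<close> down to
    \<open>2 * p - 1\<close> and the lower bound for \<open>2 * p - 1\<close> up to
    \<open>2 * p\<close>.\<close>
  have div_mono: "RT d n (2 * p - 1) a / ereal (real n ^ 2) \<le> RT d n (2 * p) a / ereal (real n ^ 2)"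
    if "n \<ge> 1" for n a
    using that by (intro ereal_divide_right_mono RT_mono) auto
  have upper: "\<exists>\<gamma>0>0. \<forall>\<gamma>\<le>\<gamma>0. \<forall>n\<ge>1. RT d n m (\<gamma> * real n) / ereal (real n ^ 2)
      \<le> ereal (1 / 2 * (1 - 1 / (real p - 1)) + \<epsilon>)" if "\<epsilon> > 0" "m = 2 * p - 1 \<or> m = 2 * p" for \<epsilon> m
  proof -
    have "p \<ge> 2" using assms by simp
    from RT_upper[OF this that(1), of d] show ?thesis
      using that(2) order_trans[OF div_mono] by blast
  qed
  have lower: "\<exists>n0. \<forall>n\<ge>n0. ereal (1 / 2 * (1 - 1 / (real p - 1)) - 1 / 2 * (1 / real n)) \<le>
      RT d n m (\<gamma> * real n) / ereal (real n ^ 2)" if "\<gamma> > 0" and m: "m = 2 * p - 1 \<or> m = 2 * p" for \<gamma> m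
  proof -
    have "d \<ge> 3" using assms by simp
    from RT_lower[OF assms(2) this \<open>\<gamma> > 0\<close>] obtain n0
      where n0: "\<And>n. n \<ge> n0 \<Longrightarrow> ereal (1 / 2 * (1 - 1 / (real p - 1)) - 1 / 2 * (1 / real n)) \<le>
        RT d n (2 * p - 1) (\<gamma> * real n) / ereal (real n ^ 2)"
      by blast
    have "ereal (1 / 2 * (1 - 1 / (real p - 1)) - 1 / 2 * (1 / real n)) \<le>
      RT d n m (\<gamma> * real n) / ereal (real n ^ 2)" if n: "n \<ge> max 1 n0" for n
      using m
    proof
      assume "m = 2 * p"
      then show ?thesis using order_trans[OF n0[of n] div_mono[of n]] n by simp
    qed (use n0[of n] n in simp)
    then show ?thesis by blast
  qed
  show ?thesis by (intro conjI RT_asymptoticI upper lower) auto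
qed

end
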